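(* Consider the M/G/1 queue with one-bit predictions under the 1bit policy in the server time cost model with fixed prediction time $c_1\ge 0$ (as described in the context). Let $$\rho^{srv}_{new}=\lambda\left(c_1+\int_0^\infty p_T(x)\,x f(x)\,dx\right),\qquad \rho_{c_1}=\lambda\int_0^\infty (x+c_1) f(x)\,dx,$$ with $\rho_{c_1}<1$. Then the expected mean response time for a predicted long job of true size $x_J$ is $$\mathbb{E}[T(x_J)]^{1bit,PL}_{srv}=\frac{\lambda}{2(1-\rho_{c_1})(1-\rho^{srv}_{new})}\int_0^\infty (x+c_1)^2 f(x)\,dx+\int_0^{x_J}\frac{1}{1-\rho^{srv}_{new}}\,da .$$
   Context: Model: jobs arrive to a single server according to a Poisson process of rate $\lambda$; service times are i.i.d. with density $f$ on $(0,\infty)$. Fix a threshold $T$. Independently over jobs, a job with service time $x$ is predicted short ($b=1$) with probability $p_T(x)$ and predicted long ($b=0$) with probability $1-p_T(x)$. Server time cost model: predictions are scheduled on the same server as the jobs. Every job first needs $c_1$ units of server time for its prediction. The age $a$ of a job is the amount of service it has received, including service for the prediction. 1bit policy in the server time cost model: predicted short jobs have priority over predicted long jobs, with First-Come-First-Served (FCFS) in each category. Formally, the server always serves the job with the lowest rank, ranks ordered lexicographically, ties broken FCFS, where a job with bit $b$ and age $a$ has rank $\langle 2,-a\rangle$ if $0\le a\le c_1$ (prediction phase), $\langle 1,-a\rangle$ if $b=1$ and $a>c_1$, and $\langle 3,-a\rangle$ if $b=0$ and $a>c_1$. The response time of a job is the time from its arrival to its completion; $\mathbb{E}[T(x_J)]^{1bit,PL}_{srv}$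 denotes the expected response time, in the system in equilibrium, of a predicted long job of true size $x_J$.
   Formalization: Here x_J is the total server time of the tagged job, prediction time c_1 included, so x_J > c_1; if x_J meant the service time alone, the displayed formula would be too small by c_1/(1-ρ_new^srv) whenever c_1 > 0. *)

theory Defs
  imports "HOL-Probability.Probability"
begin

text \<open>
  Jobs are indexed by integers in the order of arrival.  The two-sided arrival stream is described
  as it is seen by job 0, which arrives at time 0.  Job k arrives \<open>gap k\<close> time units after job
  k - 1; its service time (prediction not included) is \<open>svc k\<close>, and \<open>short k\<close> is its prediction
  bit.  The single joint density below says that the gaps are exponential with rate lam, that
  service times have density f, that a job with service time x is predicted short with probability
  p x, and that gaps are independent of service times and bits.
\<close>

locale job_stream = prob_space M
  for M :: "'w measure" +
  fixes lam :: real
    and f p :: "real \<Rightarrow> real"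
    and gap svc :: "int \<Rightarrow> 'w \<Rightarrow> real"
    and short :: "int \<Rightarrow> 'w \<Rightarrow> bool"
  assumes lam_pos: "0 < lam"
    and f_measurable: "f \<in> borel_measurable borel"
    and f_nonneg: "\<And>x. 0 \<le> f x"
    and f_support: "\<And>x. x \<le> 0 \<Longrightarrow> f x = 0"
    and f_total: "(\<integral>\<^sup>+ x. ennreal (f x) \<partial>lborel) = 1"
    and p_measurable: "p \<in> borel_measurable borel"
    and p_range: "\<And>x. 0 \<le> p x \<and> p x \<le> 1"
    and jobs_indep:
      "indep_vars (\<lambda>_. borel \<Otimes>\<^sub>M borel \<Otimes>\<^sub>M count_space UNIV)
         (\<lambda>k \<omega>. (gap k \<omega>, svc k \<omega>, short k \<omega>)) UNIV"
    and job_distributed: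
      "\<And>k. distributed M (lborel \<Otimes>\<^sub>M lborel \<Otimes>\<^sub>M count_space UNIV)
         (\<lambda>\<omega>. (gap k \<omega>, svc k \<omega>, short k \<omega>))
         (\<lambda>(e, x, b). ennreal (exponential_density lam e * f x * (if b then p x else 1 - p x)))"

text \<open>One of the two sums is always empty; job 0 arrives at time 0.\<close>

definition arrival :: "(int \<Rightarrow> real) \<Rightarrow> int \<Rightarrow> real" where
  "arrival g k = (\<Sum>i\<in>{1..k}. g i) - (\<Sum>i\<in>{k+1..0}. g i)"

definition job_rank :: "real \<Rightarrow> bool \<Rightarrow> real \<Rightarrow> nat \<times> real" where
  "job_rank c1 b a =
     (if 0 \<le> a \<and> a \<le> c1 then (2, - a) else if b then (1, - a) else (3, - a))"

definition lex_less :: "nat \<times> real \<Rightarrow> nat \<times> real \<Rightarrow> bool" where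
  "lex_less r s \<longleftrightarrow> fst r < fst s \<or> (fst r = fst s \<and> snd r < snd s)"

text \<open>
  Ranks are compared through their limits from the right, i.e. at the ages \<open>a + d\<close> for all small
  \<open>d > 0\<close>.  This matters only at age c1, where the rank jumps: with the value of the rank at c1
  itself, a job predicted long would have to be served at age c1 and must not be served at any age
  beyond c1 while another job awaits its prediction, so no continuous-time trajectory would follow
  the policy.  Ties are broken FCFS, i.e. by index.
\<close>

definition outranks :: "real \<Rightarrow> (int \<Rightarrow> bool) \<Rightarrow> (int \<Rightarrow> real) \<Rightarrow> int \<Rightarrow> int \<Rightarrow> bool" where
  "outranks c1 pred a j k \<longleftrightarrow>
     (\<forall>\<^sub>F d in at_right 0. lex_less (job_rank c1 (pred j) (a j + d)) (job_rank c1 (pred k) (a k + d))) \<or>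
     ((\<forall>\<^sub>F d in at_right 0. job_rank c1 (pred j) (a j + d) = job_rank c1 (pred k) (a k + d)) \<and> j < k)"

definition present ::
  "int set \<Rightarrow> (int \<Rightarrow> real) \<Rightarrow> (int \<Rightarrow> real) \<Rightarrow> (int \<Rightarrow> real \<Rightarrow> real) \<Rightarrow> real \<Rightarrow> int set" where
  "present J arr sz age t = {k \<in> J. arr k \<le> t \<and> age k t < sz k}"

definition served ::
  "real \<Rightarrow> int set \<Rightarrow> (int \<Rightarrow> real) \<Rightarrow> (int \<Rightarrow> real) \<Rightarrow> (int \<Rightarrow> bool) \<Rightarrow>
     (int \<Rightarrow> real \<Rightarrow> real) \<Rightarrow> real \<Rightarrow> int \<Rightarrow> bool" where
  "served c1 J arr sz pred age t j \<longleftrightarrow>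
     j \<in> present J arr sz age t \<and>
     (\<forall>k \<in> present J arr sz age t. k \<noteq> j \<longrightarrow> outranks c1 pred (\<lambda>i. age i t) j k)"

text \<open>
  \<open>age k t\<close> is the amount of service received by job k up to time t when exactly the jobs in J
  arrive, and \<open>sz k\<close> is the total server time job k needs, that is, its age at completion.
  From every time t onwards, for some positive period, the server works at unit rate
  on the job of lowest rank at time t and on no other job.  Demanding this for every t, not for
  almost every t, is what makes FCFS effective: two tied jobs have equal ages and rank decreases
  with age, so an almost-everywhere condition would let either of them be served.
\<close>

definition one_bit_schedule ::
  "real \<Rightarrow> int set \<Rightarrow> (int \<Rightarrow> real) \<Rightarrow> (int \<Rightarrow> real) \<Rightarrow> (int \<Rightarrow> bool) \<Rightarrow>
     (int \<Rightarrow> real \<Rightarrow> real) \<Rightarrow> bool" where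
  "one_bit_schedule c1 J arr sz pred age \<longleftrightarrow>
     (\<forall>k\<in>J. continuous_on UNIV (age k) \<and>
        (\<forall>t\<le>arr k. age k t = 0) \<and>
        (\<forall>t. \<forall>\<^sub>F s in at_right t.
           age k s = age k t + (if served c1 J arr sz pred age t k then s - t else 0)))"

definition response_time ::
  "(int \<Rightarrow> real) \<Rightarrow> (int \<Rightarrow> real) \<Rightarrow> (int \<Rightarrow> real \<Rightarrow> real) \<Rightarrow> int \<Rightarrow> ennreal" where
  "response_time arr sz age k = Inf {ennreal (t - arr k) | t. arr k \<le> t \<and> age k t = sz k}"

text \<open>
  Loads and moments are in \<open>ennreal\<close>, so that infinite moments of f are not read as 0.
\<close>

definition rho_new :: "real \<Rightarrow> real \<Rightarrow> (real \<Rightarrow> real) \<Rightarrow> (real \<Rightarrow> real) \<Rightarrow> ennreal" where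
  "rho_new lam c1 f p =
     ennreal lam * (ennreal c1 + (\<integral>\<^sup>+ x\<in>{0<..}. ennreal (p x * x * f x) \<partial>lborel))"

definition rho_c1 :: "real \<Rightarrow> real \<Rightarrow> (real \<Rightarrow> real) \<Rightarrow> ennreal" where
  "rho_c1 lam c1 f = ennreal lam * (\<integral>\<^sup>+ x\<in>{0<..}. ennreal ((x + c1) * f x) \<partial>lborel)"

text \<open>
  The tagged job: job 0 is given size xJ and the prediction long.  Gaps, service times and
  bits of different jobs being independent, this is conditioning on these values.  The size xJ is
  the age at which the job completes and so, like the ages, includes the c1 units of prediction;
  in particular xJ exceeds c1 by the service time of the job.
\<close>

definition tagged_size ::
  "real \<Rightarrow> real \<Rightarrow> (int \<Rightarrow> 'w \<Rightarrow> real) \<Rightarrow> 'w \<Rightarrow> int \<Rightarrow> real" where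
  "tagged_size c1 xJ svc \<omega> = (\<lambda>k. c1 + svc k \<omega>)(0 := xJ)"

definition tagged_bit :: "(int \<Rightarrow> 'w \<Rightarrow> bool) \<Rightarrow> 'w \<Rightarrow> int \<Rightarrow> bool" where
  "tagged_bit short \<omega> = (\<lambda>k. short k \<omega>)(0 := False)"

text \<open>
  \<open>age m \<omega>\<close> is the evolution of the system that starts empty just before the arrival of job -m.
  The system in equilibrium is the limit as the starting point recedes to the infinite past.
\<close>

definition run_from_past ::
  "'w measure \<Rightarrow> real \<Rightarrow> real \<Rightarrow> (int \<Rightarrow> 'w \<Rightarrow> real) \<Rightarrow> (int \<Rightarrow> 'w \<Rightarrow> real) \<Rightarrow>
     (int \<Rightarrow> 'w \<Rightarrow> bool) \<Rightarrow> (nat \<Rightarrow> 'w \<Rightarrow> int \<Rightarrow> real \<Rightarrow> real) \<Rightarrow> bool" where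
  "run_from_past M c1 xJ gap svc short age \<longleftrightarrow>
     (AE \<omega> in M. \<forall>m. one_bit_schedule c1 {- int m..} (arrival (\<lambda>k. gap k \<omega>))
        (tagged_size c1 xJ svc \<omega>) (tagged_bit short \<omega>) (age m \<omega>))"

definition past_response ::
  "real \<Rightarrow> real \<Rightarrow> (int \<Rightarrow> 'w \<Rightarrow> real) \<Rightarrow> (int \<Rightarrow> 'w \<Rightarrow> real) \<Rightarrow>
     (nat \<Rightarrow> 'w \<Rightarrow> int \<Rightarrow> real \<Rightarrow> real) \<Rightarrow> nat \<Rightarrow> 'w \<Rightarrow> ennreal" where
  "past_response c1 xJ gap svc age m \<omega> =
     response_time (arrival (\<lambda>k. gap k \<omega>)) (tagged_size c1 xJ svc \<omega>) (age m \<omega>) 0"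

definition equilibrium_response ::
  "real \<Rightarrow> real \<Rightarrow> (int \<Rightarrow> 'w \<Rightarrow> real) \<Rightarrow> (int \<Rightarrow> 'w \<Rightarrow> real) \<Rightarrow>
     (nat \<Rightarrow> 'w \<Rightarrow> int \<Rightarrow> real \<Rightarrow> real) \<Rightarrow> 'w \<Rightarrow> ennreal" where
  "equilibrium_response c1 xJ gap svc age \<omega> =
     lim (\<lambda>m. past_response c1 xJ gap svc age m \<omega>)"

end

theory Submission
  imports Defs "HOL-Real_Asymp.Real_Asymp"
begin

text \<open>
  Fix a sample path.  Until the tagged job completes, the server only works on jobs that the tagged
  job has to wait for: everything present at its arrival, and of every later job its prediction and,
  if it is predicted short, its service.  Hence the response time is the first time at which the work
  \<open>wait + xJ\<close> found at the arrival, together with these later contributions, has been cleared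
  at unit rate.  A Wald-type identity for this clearing time, in which the exponential gaps turn the
  expected number of arrivals into \<open>lam\<close> times the expected time, gives the mean
  \<open>(E wait + xJ) / (1 - rho_new)\<close>.  Before time 0 the total work does not depend on the policy,
  so \<open>wait\<close> obeys the Lindley recursion, increases as the start of the system recedes into the
  past, and has the Pollaczek-Khinchine mean in the limit.
\<close>

subsection \<open>Sample paths\<close>

text \<open>On a sample path, a schedule is specified only by its behaviour just to the right of
  each time; no list of service epochs is given. So every invariant is made a closed set of times
  and carried across an interarrival interval by induction on the reals. The delicate invariant
  concerns long jobs: beyond age \<open>c1\<close> a larger age wins, so an earlier long job stays
  ahead of the tagged job only because the tagged job cannot pass age \<open>c1\<close> before all
  jobs that arrived earlier are finished. In the probabilistic part, values in
  \<open>ennreal\<close> cannot be cancelled freely and the limit of the mean waits may be infinite.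
  Balances are therefore kept additive, cancellation is done only for quantities shown to be finite,
  and it is the transforms of the waits that are taken to the limit. The constant in the
  Pollaczek-Khinchine transform is found by squeezing the limit of the probabilities that an
  arriving job finds the system empty.\<close>

lemma closed_interval_induct:
  fixes a b :: real
  assumes "closed S" "a \<in> S"
    and step: "\<And>t. a \<le> t \<Longrightarrow> t < b \<Longrightarrow> t \<in> S \<Longrightarrow> \<forall>\<^sub>F s in at_right t. s \<in> S"
  shows "{a..b} \<subseteq> S"
proof
  fix t assume t: "t \<in> {a..b}"
  show "t \<in> S"
  proof (rule ccontr)
    assume "t \<notin> S"
    define C where "C = S \<inter> {a..t}"
    have C: "closed C" "C \<noteq> {}" "bdd_above C"
      using assms t by (auto simp: C_def)
    \<comment> \<open>The last time reached lies in the closed set, and the hypothesis at that time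
      yields a later one.\<close>
    define c where "c = Sup C"
    have "c \<in> C" using C closed_contains_Sup by (auto simp: c_def)
    with \<open>t \<notin> S\<close> have c: "c \<in> S" "a \<le> c" "c < t"
      by (auto simp: C_def order_less_le)
    from step[OF c(2) _ c(1)] c t have "\<forall>\<^sub>F s in at_right c. s \<in> S" by auto
    moreover have "\<forall>\<^sub>F s in at_right c. c < s \<and> s < t"
      using c by (auto simp: eventually_at_right_field)
    ultimately have "\<forall>\<^sub>F s in at_right c. s \<in> S \<and> c < s \<and> s < t"
      by eventually_elim auto
    then obtain s where "s \<in> S" "c < s" "s < t"
      by (metis (no_types, lifting) eventually_happens trivial_limit_at_right_real)
    then have "s \<in> C" using c by (auto simp: C_def)
    with C have "s \<le> c" by (auto simp: c_def intro: cSup_upper)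
    with \<open>c < s\<close> show False by simp
  qed
qed

text \<open>The first component of the rank at ages just above \<open>a\<close>. The test is strict
  because just after age \<open>c1\<close> the prediction is over.\<close>

definition rank_class :: "real \<Rightarrow> bool \<Rightarrow> real \<Rightarrow> nat" where
  "rank_class c1 b a = (if a < c1 then 2 else if b then 1 else 3)"

lemma eventually_job_rank:
  assumes "0 \<le> a"
  shows "\<forall>\<^sub>F d in at_right 0. job_rank c1 b (a + d) = (rank_class c1 b a, - (a + d))"
proof -
  have "\<forall>\<^sub>F d in at_right 0. 0 < d \<and> (a < c1 \<longrightarrow> d < c1 - a)"
    by (cases "a < c1") (auto simp: eventually_at_right_field intro: exI[of _ "c1 - a"] exI[of _ 1])
  then show ?thesis
    using assms by (auto elim!: eventually_mono simp: job_rank_def rank_class_def)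
qed

text \<open>Both ranks move with the same shift \<open>d\<close>, which cancels in the second
  components. What remains is a comparison of classes, then of ages (larger first), then of
  indices.\<close>

lemma outranks_iff:
  assumes "0 \<le> a j" "0 \<le> a k"
  shows "outranks c1 pred a j k \<longleftrightarrow>
    rank_class c1 (pred j) (a j) < rank_class c1 (pred k) (a k) \<or>
    (rank_class c1 (pred j) (a j) = rank_class c1 (pred k) (a k) \<and>
      (a k < a j \<or> (a j = a k \<and> j < k)))"
proof -
  note ev = eventually_conj[OF eventually_job_rank[OF assms(1), of c1 "pred j"]
      eventually_job_rank[OF assms(2), of c1 "pred k"]]
  have "(\<forall>\<^sub>F d in at_right 0. lex_less (job_rank c1 (pred j) (a j + d)) (job_rank c1 (pred k) (a k + d)))
     \<longleftrightarrow> (\<forall>\<^sub>F d in at_right (0::real). rank_class c1 (pred j) (a j) < rank_class c1 (pred k) (a k) \<or>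
       (rank_class c1 (pred j) (a j) = rank_class c1 (pred k) (a k) \<and> a k < a j))"
    by (rule eventually_cong[OF ev]) (auto simp: lex_less_def)
  moreover have "(\<forall>\<^sub>F d in at_right 0. job_rank c1 (pred j) (a j + d) = job_rank c1 (pred k) (a k + d))
     \<longleftrightarrow> (\<forall>\<^sub>F d in at_right (0::real). rank_class c1 (pred j) (a j) = rank_class c1 (pred k) (a k) \<and> a k = a j)"
    by (rule eventually_cong[OF ev]) auto
  ultimately show ?thesis
    unfolding outranks_def by auto
qed

lemma arrival_diff: "arrival g k - arrival g (k - 1) = g k"
proof (cases "1 \<le> k")
  case True
  then have "{1..k} = insert k {1..k-1}" "{k+1..0} = {}" "{k-1+1..0} = {}" by auto
  then show ?thesis by (simp add: arrival_def)
next
  case False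
  then have "{k-1+1..0} = insert k {k+1..0}" "{1..k} = {}" "{1..k-1} = {}" by auto
  then show ?thesis by (simp add: arrival_def)
qed

lemma strict_mono_arrival:
  assumes "\<And>k. 0 < g k"
  shows "strict_mono (arrival g)"
proof (rule strict_monoI)
  fix i j :: int assume "i < j"
  then show "arrival g i < arrival g j"
  proof (induction j rule: int_gr_induct)
    case base
    then show ?case using arrival_diff[of g "i+1"] assms[of "i+1"] by simp
  next
    case (step k)
    then show ?case using arrival_diff[of g "k+1"] assms[of "k+1"] by simp
  qed
qed

section \<open>Unfinished work on a fixed sample path\<close>

locale one_bit_path =
  fixes c1 :: real and m :: nat and arr sz :: "int \<Rightarrow> real" and pred :: "int \<Rightarrow> bool"
    and age :: "int \<Rightarrow> real \<Rightarrow> real"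
  assumes c1_nonneg: "0 \<le> c1"
    and sz_gt: "\<And>k. c1 < sz k"
    and strict_mono_arr: "strict_mono arr"
    and schedule: "one_bit_schedule c1 {- int m..} arr sz pred age"
begin

abbreviation present_at where "present_at \<equiv> present {- int m..} arr sz age"
abbreviation served_at where "served_at \<equiv> served c1 {- int m..} arr sz pred age"

lemma arr_less_iff [simp]: "arr i < arr j \<longleftrightarrow> i < j" and arr_le_iff [simp]: "arr i \<le> arr j \<longleftrightarrow> i \<le> j"
  using strict_mono_arr by (auto simp: strict_mono_less strict_mono_less_eq)

lemma continuous_age [continuous_intros]: "k \<ge> - int m \<Longrightarrow> continuous_on UNIV (age k)"
  using schedule by (auto simp: one_bit_schedule_def)

lemma age_before: "k \<ge> - int m \<Longrightarrow> t \<le> arr k \<Longrightarrow> age k t = 0"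
  using schedule by (auto simp: one_bit_schedule_def)

lemma present_eq:
  assumes "arr i \<le> t" "t < arr (i + 1)"
  shows "present_at t = {k \<in> {- int m..i}. age k t < sz k}"
proof -
  have "arr k \<le> t \<longleftrightarrow> k \<le> i" for k
  proof
    assume "arr k \<le> t"
    then have "arr k < arr (i + 1)" using assms by linarith
    then show "k \<le> i" by simp
  next
    assume "k \<le> i"
    then have "arr k \<le> arr i" by simp
    then show "arr k \<le> t" using assms by linarith
  qed
  then show ?thesis by (auto simp: present_def)
qed

text \<open>On the finitely many jobs present, \<open>outranks\<close> is a strict total order, so
  its least element is the unique job served. Finiteness also gives one right neighbourhood on which
  the increment formula holds for all arrived jobs. The ages must be nonnegative for ranks to be
  compared by \<open>outranks_iff\<close>.\<close>

lemma schedule_step: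
  assumes t: "arr i \<le> t" "t < arr (i + 1)" and nonneg: "\<And>k. k \<in> {- int m..i} \<Longrightarrow> 0 \<le> age k t"
  obtains (idle) "present_at t = {}" "\<forall>\<^sub>F s in at_right t. \<forall>k\<in>{- int m..i}. age k s = age k t"
  | (busy) j where "served_at t j" "j \<in> {- int m..i}"
      "\<forall>\<^sub>F s in at_right t. \<forall>k\<in>{- int m..i}. age k s = age k t + (if k = j then s - t else 0)"
proof -
  have ev: "\<forall>\<^sub>F s in at_right t. \<forall>k\<in>{- int m..i}.
      age k s = age k t + (if served_at t k then s - t else 0)"
    using schedule unfolding one_bit_schedule_def by (intro eventually_ball_finite) auto
  show thesis
  proof (cases "present_at t = {}")
    case True
    then have "\<not> served_at t k" for k by (auto simp: served_def)
    with ev idle True show ?thesis by auto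
  next
    case False
    let ?P = "present_at t"
    let ?R = "outranks c1 pred (\<lambda>i. age i t)"
    have sub: "?P \<subseteq> {- int m..i}"
      by (auto simp: present_eq[OF t])
    then have P: "finite ?P" "\<And>k. k \<in> ?P \<Longrightarrow> 0 \<le> age k t"
      using nonneg by (auto intro: finite_subset)
    define c where "c k = rank_class c1 (pred k) (age k t)" for k
    have iff: "?R x y \<longleftrightarrow> c x < c y \<or> (c x = c y \<and> (age y t < age x t \<or> (age x t = age y t \<and> x < y)))"
      if "x \<in> ?P" "y \<in> ?P" for x y
      unfolding c_def using P(2)[OF that(1)] P(2)[OF that(2)] by (rule outranks_iff)
    have tr: "transp_on ?P ?R"
    proof (rule transp_onI)
      fix x y z assume "x \<in> ?P" "y \<in> ?P" "z \<in> ?P" "?R x y" "?R y z"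
      then show "?R x z" by (simp only: iff) linarith
    qed
    have as: "asymp_on ?P ?R"
    proof (rule asymp_onI)
      fix x y assume "x \<in> ?P" "y \<in> ?P" "?R x y"
      then show "\<not> ?R y x" by (simp only: iff) linarith
    qed
    have tot: "totalp_on ?P ?R"
    proof (rule totalp_onI)
      fix x y assume "x \<in> ?P" "y \<in> ?P" "x \<noteq> y"
      then show "?R x y \<or> ?R y x" by (simp only: iff) linarith
    qed
    have "\<exists>j\<in>?P. \<forall>k\<in>?P. k \<noteq> j \<longrightarrow> ?R j k"
      by (rule Finite_Set.bex_least_element[OF P(1) False tr tot])
    then obtain j where j: "j \<in> ?P" "\<forall>k\<in>?P. k \<noteq> j \<longrightarrow> ?R j k" ..
    have served: "served_at t j"
      unfolding served_def using j by (rule conjI)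
    have unique: "k = j" if "served_at t k" for k
    proof (rule ccontr)
      assume "k \<noteq> j"
      have k: "k \<in> ?P" "\<forall>i\<in>?P. i \<noteq> k \<longrightarrow> ?R k i"
        using that unfolding served_def by (rule conjunct1, rule conjunct2)
      have "?R j k" "?R k j" using j k \<open>k \<noteq> j\<close> by metis+
      then show False using asymp_onD[OF as] j(1) k(1) by metis
    qed
    have "served_at t k \<longleftrightarrow> k = j" for k
      using served unique by metis
    then have "\<forall>\<^sub>F s in at_right t. \<forall>k\<in>{- int m..i}.
        age k s = age k t + (if k = j then s - t else 0)"
      using ev by (simp only:)
    moreover have "j \<in> {- int m..i}" using sub j(1) by (rule subsetD)
    ultimately show ?thesis using busy[OF served] by metis
  qed
qed

text \<open>The server idles only when no job is present, so unfinished work falls at unit rate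
  until it is 0, whichever job is served. The age bounds belong to the same induction because
  \<open>schedule_step\<close> needs nonnegative ages.\<close>

lemma total_work:
  assumes t: "t \<in> {arr i..arr (i + 1)}" and start: "\<And>k. k \<in> {- int m..i} \<Longrightarrow> age k (arr i) \<in> {0..sz k}"
  shows "\<And>k. k \<in> {- int m..i} \<Longrightarrow> age k t \<in> {0..sz k}"
    and "(\<Sum>k\<in>{- int m..i}. sz k - age k t) =
      max 0 ((\<Sum>k\<in>{- int m..i}. sz k - age k (arr i)) - (t - arr i))"
proof -
  define I where "I = {- int m..i}"
  have I: "finite I" by (simp add: I_def)
  have cont: "continuous_on UNIV (age k)" if "k \<in> I" for k
    using that by (simp add: I_def continuous_age)
  define V where "V = (\<Sum>k\<in>I. sz k - age k (arr i))"
  define S where "S = {t. (\<forall>k\<in>I. 0 \<le> age k t \<and> age k t \<le> sz k) \<and>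
    (\<Sum>k\<in>I. sz k - age k t) = max 0 (V - (t - arr i))}"
  have "{arr i..arr (i + 1)} \<subseteq> S"
  proof (rule closed_interval_induct)
    have "S = (\<Inter>k\<in>I. {t. 0 \<le> age k t} \<inter> {t. age k t \<le> sz k}) \<inter>
        {t. (\<Sum>k\<in>I. sz k - age k t) = max 0 (V - (t - arr i))}"
      by (auto simp: S_def)
    then show "closed S"
      by (auto intro!: closed_INT closed_Int closed_Collect_le closed_Collect_eq
          continuous_intros cont)
    have "0 \<le> V" using start by (auto simp: V_def I_def intro!: sum_nonneg)
    then show "arr i \<in> S"
      using start by (auto simp: S_def V_def I_def)
  next
    fix t assume t: "arr i \<le> t" "t < arr (i + 1)" "t \<in> S"
    from t(3) have ages: "\<And>k. k \<in> I \<Longrightarrow> 0 \<le> age k t" "\<And>k. k \<in> I \<Longrightarrow> age k t \<le> sz k"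
      and sum: "(\<Sum>k\<in>I. sz k - age k t) = max 0 (V - (t - arr i))"
      by (auto simp: S_def)
    have gt: "\<forall>\<^sub>F s in at_right t. t < s" by (auto simp: eventually_at_filter)
    show "\<forall>\<^sub>F s in at_right t. s \<in> S"
    proof (rule schedule_step[OF t(1,2)])
      show "0 \<le> age k t" if "k \<in> {- int m..i}" for k using ages that by (simp add: I_def)
    next
      assume none: "present_at t = {}"
        and step: "\<forall>\<^sub>F s in at_right t. \<forall>k\<in>{- int m..i}. age k s = age k t"
      have "age k t = sz k" if "k \<in> I" for k
        using none ages(2)[OF that] that by (force simp: present_eq[OF t(1,2)] I_def)
      with sum have *: "V - (t - arr i) \<le> 0" by simp
      from gt step show ?thesis
      proof eventually_elim
        case (elim s)
        have "(\<Sum>k\<in>I. sz k - age k s) = (\<Sum>k\<in>I. sz k - age k t)"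
          using elim by (intro sum.cong) (auto simp: I_def)
        with * sum elim ages show "s \<in> S" by (auto simp: S_def I_def)
      qed
    next
      fix j assume "served_at t j" and j: "j \<in> {- int m..i}"
        and step: "\<forall>\<^sub>F s in at_right t. \<forall>k\<in>{- int m..i}. age k s = age k t + (if k = j then s - t else 0)"
      then have less: "age j t < sz j" by (auto simp: served_def present_def)
      \<comment> \<open>The positive remaining work of \<open>j\<close> shows that the truncation at
        0 is not active.\<close>
      have "sz j - age j t \<le> (\<Sum>k\<in>I. sz k - age k t)"
        using ages j by (intro member_le_sum I) (auto simp: I_def)
      with less sum have *: "V - (t - arr i) = (\<Sum>k\<in>I. sz k - age k t)" "sz j - age j t \<le> V - (t - arr i)"
        by auto
      \<comment> \<open>Stay before the time at which \<open>j\<close> would complete, so that no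
        age overshoots its size.\<close>
      have "\<forall>\<^sub>F s in at_right t. s < t + (sz j - age j t)"
        using less by (auto simp: eventually_at_right_field intro: exI[of _ "t + (sz j - age j t)"])
      from gt step this show ?thesis
      proof eventually_elim
        case (elim s)
        have "(\<Sum>k\<in>I. sz k - age k s) = (\<Sum>k\<in>I. (sz k - age k t) - (if k = j then s - t else 0))"
          using elim by (intro sum.cong) (auto simp: I_def)
        also have "\<dots> = (\<Sum>k\<in>I. sz k - age k t) - (s - t)"
          using j by (simp add: sum_subtractf I I_def[symmetric])
        finally have "(\<Sum>k\<in>I. sz k - age k s) = max 0 (V - (s - arr i))"
          using * elim by auto
        moreover have "0 \<le> age k s \<and> age k s \<le> sz k" if "k \<in> I" for k
          using elim ages[OF that] that by (cases "k = j") (auto simp: I_def)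
        ultimately show "s \<in> S" by (auto simp: S_def)
      qed
    qed
  qed
  with t show "\<And>k. k \<in> {- int m..i} \<Longrightarrow> age k t \<in> {0..sz k}"
    "(\<Sum>k\<in>{- int m..i}. sz k - age k t) =
      max 0 ((\<Sum>k\<in>{- int m..i}. sz k - age k (arr i)) - (t - arr i))"
    by (auto simp: S_def I_def V_def)
qed

text \<open>The service that job \<open>k\<close> must have received before job 0 can complete, if \<open>k\<close> arrives before that.\<close>

definition target :: "int \<Rightarrow> real" where
  "target k = (if 0 < k \<and> \<not> pred k then c1 else sz k)"

lemma target_0 [simp]: "target 0 = sz 0"
  by (simp add: target_def)

text \<open>While job 0 is unfinished the server never idles and serves only jobs below their
  targets: a later long job at age \<open>c1\<close> loses to job 0, by class during the prediction
  of job 0 and by age or index afterwards. Hence the total shortfall falls at unit rate. No other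
  shortfall is left when job 0 finishes, so it completes exactly when the total reaches 0. The
  hypothesis \<open>before\<close> reappears as the last conclusion to be passed on to the next
  arrival.\<close>

lemma priority_work:
  assumes i: "0 \<le> i" and long: "\<not> pred 0"
    and start: "\<And>k. k \<in> {- int m..i} \<Longrightarrow> age k (arr i) \<in> {0..target k}"
    and start0: "age 0 (arr i) < sz 0"
    and before: "\<And>k. k \<in> {- int m..<0} \<Longrightarrow> c1 < age 0 (arr i) \<Longrightarrow> age k (arr i) = sz k"
  defines "R \<equiv> \<Sum>k\<in>{- int m..i}. target k - age k (arr i)"
  assumes t: "t \<in> {arr i..min (arr (i + 1)) (arr i + R)}"
  shows "\<And>k. k \<in> {- int m..i} \<Longrightarrow> age k t \<in> {0..target k}"
    and "(\<Sum>k\<in>{- int m..i}. target k - age k t) = R - (t - arr i)"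
    and "age 0 t = sz 0 \<longleftrightarrow> t = arr i + R"
    and "\<And>k. k \<in> {- int m..<0} \<Longrightarrow> c1 < age 0 t \<Longrightarrow> age k t = sz k"
proof -
  define I where "I = {- int m..i}"
  have I: "finite I" "0 \<in> I" using i by (simp_all add: I_def)
  have cont: "continuous_on UNIV (age k)" if "k \<in> I" for k
    using that by (simp add: I_def continuous_age)
  define rest where "rest t = (\<Sum>k\<in>I - {0}. target k - age k t)" for t
  \<comment> \<open>An arrival may interrupt job 0 beyond age \<open>c1\<close>. So within this
    interval the other shortfalls are excluded only once job 0 is also past the age it had at the
    start.\<close>
  define base where "base = max c1 (age 0 (arr i))"
  \<comment> \<open>Both implications, that the other shortfalls vanish once job 0 is past
    \<open>base\<close> and that earlier jobs are finished once it is past \<open>c1\<close>, are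
    written as vanishing products of continuous functions; this makes \<open>S\<close>
    closed.\<close>
  define S where "S = {t. (\<forall>k\<in>I. 0 \<le> age k t \<and> age k t \<le> target k) \<and>
    (\<Sum>k\<in>I. target k - age k t) = R - (t - arr i) \<and> max 0 (age 0 t - base) * rest t = 0 \<and>
    (\<forall>k\<in>{- int m..<0}. max 0 (age 0 t - c1) * (sz k - age k t) = 0)}"
  have split: "(\<Sum>k\<in>I. target k - age k t) = (sz 0 - age 0 t) + rest t" for t
    using I by (simp add: rest_def sum.remove[of _ 0])
  have base: "base < sz 0" using start0 sz_gt by (simp add: base_def)
  have rest_zero: "rest t = 0" if "t \<in> S" "age 0 t = sz 0" for t
    using that base by (auto simp: S_def)
  have sub: "{arr i..min (arr (i + 1)) (arr i + R)} \<subseteq> S"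
  proof (rule closed_interval_induct)
    have "S = (\<Inter>k\<in>I. {t. 0 \<le> age k t} \<inter> {t. age k t \<le> target k}) \<inter>
        {t. (\<Sum>k\<in>I. target k - age k t) = R - (t - arr i)} \<inter> {t. max 0 (age 0 t - base) * rest t = 0} \<inter>
        (\<Inter>k\<in>{- int m..<0}. {t. max 0 (age 0 t - c1) * (sz k - age k t) = 0})"
      by (auto simp: S_def)
    moreover have "closed (\<Inter>k\<in>I. {t. 0 \<le> age k t} \<inter> {t. age k t \<le> target k})"
      by (intro closed_INT ballI closed_Int closed_Collect_le continuous_intros cont)
    moreover have "closed {t. (\<Sum>k\<in>I. target k - age k t) = R - (t - arr i)}"
      by (intro closed_Collect_eq continuous_intros cont)
    moreover have "closed {t. max 0 (age 0 t - base) * rest t = 0}"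
      unfolding rest_def by (intro closed_Collect_eq continuous_intros cont I) auto
    moreover have "closed (\<Inter>k\<in>{- int m..<0}. {t. max 0 (age 0 t - c1) * (sz k - age k t) = 0})"
      using i by (intro closed_INT ballI closed_Collect_eq continuous_intros cont I) (auto simp: I_def)
    ultimately show "closed S"
      by (simp only: closed_Int)
    have "max 0 (age 0 (arr i) - c1) * (sz k - age k (arr i)) = 0" if "k \<in> {- int m..<0}" for k
      using before[OF that] by (cases "c1 < age 0 (arr i)") simp_all
    moreover have "0 \<le> age k (arr i) \<and> age k (arr i) \<le> target k" if "k \<in> I" for k
      using start[of k] that by (simp add: I_def)
    moreover have "max 0 (age 0 (arr i) - base) * rest (arr i) = 0"
      by (simp add: base_def)
    moreover have "(\<Sum>k\<in>I. target k - age k (arr i)) = R - (arr i - arr i)"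
      unfolding R_def I_def by simp
    ultimately show "arr i \<in> S"
      unfolding S_def by blast
  next
    fix t assume t: "arr i \<le> t" "t < min (arr (i + 1)) (arr i + R)" "t \<in> S"
    from t(3) have ages: "\<And>k. k \<in> I \<Longrightarrow> 0 \<le> age k t" "\<And>k. k \<in> I \<Longrightarrow> age k t \<le> target k"
      and sum: "(\<Sum>k\<in>I. target k - age k t) = R - (t - arr i)"
      and excl: "max 0 (age 0 t - base) * rest t = 0"
      and excl': "\<And>k. k \<in> {- int m..<0} \<Longrightarrow> max 0 (age 0 t - c1) * (sz k - age k t) = 0"
      by (auto simp: S_def)
    have t': "t < arr (i + 1)" using t by simp
    have pres: "k \<in> present_at t" if "k \<in> I" "age k t < target k" for k
      using that sz_gt[of k] by (auto simp: present_eq[OF t(1) t'] I_def target_def split: if_splits)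
    \<comment> \<open>A completed job 0 would force \<open>rest t = 0\<close> and a zero sum, but
      the sum is positive before \<open>arr i + R\<close>.\<close>
    have "age 0 t \<noteq> sz 0"
      using rest_zero[OF t(3)] sum t(2) split[of t] by auto
    then have less0: "age 0 t < sz 0" using ages(2)[OF I(2)] by simp
    then have pres0: "0 \<in> present_at t" using pres[OF I(2)] by simp
    have gt: "\<forall>\<^sub>F s in at_right t. t < s" by (auto simp: eventually_at_filter)
    show "\<forall>\<^sub>F s in at_right t. s \<in> S"
    proof (rule schedule_step[OF t(1) t'])
      show "0 \<le> age k t" if "k \<in> {- int m..i}" for k using ages that by (simp add: I_def)
    next
      assume "present_at t = {}"
      with pres0 show ?thesis by simp
    next
      fix j assume served: "served_at t j" and "j \<in> {- int m..i}"
        and step: "\<forall>\<^sub>F s in at_right t. \<forall>k\<in>{- int m..i}. age k s = age k t + (if k = j then s - t else 0)"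
      then have j: "j \<in> I" by (simp add: I_def)
      have first: "outranks c1 pred (\<lambda>i. age i t) j k" if "k \<in> present_at t" "k \<noteq> j" for k
        using served that by (auto simp: served_def)
      have iff: "outranks c1 pred (\<lambda>i. age i t) x y \<longleftrightarrow>
          rank_class c1 (pred x) (age x t) < rank_class c1 (pred y) (age y t) \<or>
          (rank_class c1 (pred x) (age x t) = rank_class c1 (pred y) (age y t) \<and>
            (age y t < age x t \<or> (age x t = age y t \<and> x < y)))" if "x \<in> I" "y \<in> I" for x y
        using ages(1)[OF that(1)] ages(1)[OF that(2)] by (rule outranks_iff)
      have less: "age j t < target j"
      proof (rule ccontr)
        assume "\<not> ?thesis"
        then have eq: "age j t = target j" using ages(2)[OF j] by simp
        have "age j t < sz j" using served by (auto simp: served_def present_def)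
        with eq have *: "0 < j" "\<not> pred j" "age j t = c1" by (auto simp: target_def split: if_splits)
        then have "outranks c1 pred (\<lambda>i. age i t) j 0"
          using first[OF pres0] by simp
        with * long show False
          by (auto simp: iff[OF j I(2)] rank_class_def split: if_splits)
      qed
      \<comment> \<open>Job 0 is last in the order of service among the jobs below their targets.\<close>
      have rest0: "age k t = target k" if "j = 0" "c1 \<le> age 0 t" and k: "k \<in> I - {0}" for k
        proof (rule ccontr)
          assume "\<not> ?thesis"
          then have lt: "age k t < target k" using ages(2)[of k] k by auto
          then have "outranks c1 pred (\<lambda>i. age i t) 0 k"
            using first[OF pres] k \<open>j = 0\<close> by auto
          then have "\<not> pred k" "c1 \<le> age k t" "age k t < age 0 t \<or> 0 < k"
            using k long \<open>c1 \<le> age 0 t\<close>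
            by (auto simp: iff[OF I(2)] rank_class_def split: if_splits)
          \<comment> \<open>A later long job has target \<open>c1\<close>; an earlier one is behind
            job 0 in age, so job 0 is past \<open>c1\<close> and \<open>excl'\<close> says that the
            earlier one is finished.\<close>
          then show False
            using k lt excl'[of k] by (auto simp: target_def I_def max_def split: if_splits)
        qed
      have "\<forall>\<^sub>F s in at_right t. s < t + (target j - age j t)"
        using less by (auto simp: eventually_at_right_field intro: exI[of _ "t + (target j - age j t)"])
      \<comment> \<open>Below age \<open>c1\<close> job 0 can be served while others are short of
        their targets, so it must not cross \<open>c1\<close> within the neighbourhood.\<close>
      moreover have "\<forall>\<^sub>F s in at_right t. age 0 t < c1 \<longrightarrow> s < t + (c1 - age 0 t)"
        by (cases "age 0 t < c1")
          (auto simp: eventually_at_right_field intro: exI[of _ "t + (c1 - age 0 t)"])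
      ultimately show ?thesis
        using gt step
      proof eventually_elim
        case (elim s)
        have "(\<Sum>k\<in>I. target k - age k s) = (\<Sum>k\<in>I. (target k - age k t) - (if k = j then s - t else 0))"
          using elim by (intro sum.cong) (auto simp: I_def)
        also have "\<dots> = (\<Sum>k\<in>I. target k - age k t) - (s - t)"
          using j by (simp add: sum_subtractf I)
        finally have "(\<Sum>k\<in>I. target k - age k s) = R - (s - arr i)"
          using sum by simp
        moreover have "0 \<le> age k s \<and> age k s \<le> target k" if "k \<in> I" for k
          using elim ages[OF that] that by (cases "k = j") (auto simp: I_def)
        moreover have "max 0 (age 0 s - base) * rest s = 0"
        proof (cases "j = 0")
          case True
          have "rest s = rest t"
            unfolding rest_def using elim True by (intro sum.cong) (auto simp: I_def)
          moreover have "rest t = 0" if "c1 \<le> age 0 t"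
            unfolding rest_def using rest0[OF True that] by simp
          ultimately show ?thesis
            using True elim I by (cases "c1 \<le> age 0 t") (auto simp: I_def base_def)
        next
          case False
          have "target j - age j t \<le> rest t"
            unfolding rest_def using j ages I False by (intro member_le_sum) auto
          with less excl have "age 0 t \<le> base" by (auto simp: max_def split: if_splits)
          then show ?thesis using elim False I by (auto simp: I_def)
        qed
        moreover have "max 0 (age 0 s - c1) * (sz k - age k s) = 0" if k: "k \<in> {- int m..<0}" for k
        proof (cases "j = 0")
          case True
          have "k \<in> I - {0}" using k i by (auto simp: I_def)
          then have "age k t = sz k" if "c1 \<le> age 0 t"
            using rest0[OF True that] k by (auto simp: target_def)
          then show ?thesis
            using True elim I \<open>k \<in> I - {0}\<close> by (cases "c1 \<le> age 0 t") (auto simp: I_def)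
        next
          case False
          then have "age 0 s = age 0 t" "j \<noteq> k \<Longrightarrow> age k s = age k t"
            using elim I k i by (auto simp: I_def)
          moreover have "age 0 t \<le> c1" if "j = k"
            using excl'[OF k] less k that by (auto simp: target_def max_def split: if_splits)
          ultimately show ?thesis
            using excl'[OF k] by (cases "j = k") auto
        qed
        ultimately show "s \<in> S" unfolding S_def by blast
      qed
    qed
  qed
  with t show "\<And>k. k \<in> {- int m..i} \<Longrightarrow> age k t \<in> {0..target k}"
    and sum: "(\<Sum>k\<in>{- int m..i}. target k - age k t) = R - (t - arr i)"
    by (auto simp: S_def I_def)
  have tS: "t \<in> S" using sub t by blast
  then show "\<And>k. k \<in> {- int m..<0} \<Longrightarrow> c1 < age 0 t \<Longrightarrow> age k t = sz k"
    by (auto simp: S_def max_def split: if_splits)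
  from tS have "0 \<le> rest t"
    unfolding rest_def by (intro sum_nonneg) (auto simp: S_def)
  moreover have "age 0 t \<le> sz 0" using tS I by (force simp: S_def)
  ultimately show "age 0 t = sz 0 \<longleftrightarrow> t = arr i + R"
    using split[of t] sum rest_zero[OF tS] by (auto simp: I_def)
qed

end

text \<open>
  The work just after the arrival of job \<open>k\<close>, if the system is empty before the arrival of job
  \<open>k - n + 1\<close>.
\<close>

primrec workload :: "(int \<Rightarrow> real) \<Rightarrow> (int \<Rightarrow> real) \<Rightarrow> nat \<Rightarrow> int \<Rightarrow> real" where
  "workload g s 0 k = 0"
| "workload g s (Suc n) k = max 0 (workload g s n (k - 1) - g k) + s k"

text \<open>
  The work that must be done before the tagged job completes, just after the \<open>n\<close>-th arrival after
  it, of which \<open>y\<close> is the contribution of the arriving job; 0 once the tagged job has completed.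
\<close>

primrec backlog :: "(int \<Rightarrow> real) \<Rightarrow> (int \<Rightarrow> real) \<Rightarrow> real \<Rightarrow> nat \<Rightarrow> real" where
  "backlog g y z 0 = z"
| "backlog g y z (Suc n) =
    (if g (int n + 1) < backlog g y z n then backlog g y z n - g (int n + 1) + y (int n + 1) else 0)"

text \<open>Term \<open>n\<close> is the part of the gap following the \<open>n\<close>-th later
  arrival during which the backlog lasts. As a series of nonnegative terms, the time can be
  integrated term by term before it is known to be finite.\<close>

definition clearing_time :: "(int \<Rightarrow> real) \<Rightarrow> (int \<Rightarrow> real) \<Rightarrow> real \<Rightarrow> ennreal" where
  "clearing_time g y z = (\<Sum>n. ennreal (min (backlog g y z n) (g (int n + 1))))"

section \<open>Elementary properties of the two recursions\<close>

lemma workload_nonneg: "(\<And>k. 0 \<le> s k) \<Longrightarrow> 0 \<le> workload g s n k"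
  by (cases n) auto

lemma workload_mono:
  assumes "\<And>k. 0 \<le> s k"
  shows "workload g s n k \<le> workload g s (Suc n) k"
proof (induction n arbitrary: k)
  case 0
  then show ?case using assms by simp
next
  case (Suc n)
  from Suc[of "k - 1"] show ?case
    by (simp only: workload.simps)
qed

lemma backlog_nonneg:
  assumes "\<And>k. 0 \<le> y k" "0 \<le> z"
  shows "0 \<le> backlog g y z n"
  by (induction n) (use assms in \<open>auto intro: add_nonneg_nonneg\<close>)

text \<open>Contributions are nonnegative, so the step jumps upwards where the backlog passes the
  gap and is monotone in the backlog.\<close>

lemma backlog_mono:
  assumes "\<And>k. 0 \<le> y k" "z \<le> z'"
  shows "backlog g y z n \<le> backlog g y z' n"
  by (induction n) (use assms in \<open>auto intro: add_nonneg_nonneg\<close>)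

lemma clearing_time_mono:
  assumes "\<And>k. 0 \<le> y k" "z \<le> z'"
  shows "clearing_time g y z \<le> clearing_time g y z'"
  unfolding clearing_time_def
  by (intro suminf_le summableI ennreal_leI min.mono backlog_mono assms) auto

lemma backlog_eq_0:
  assumes "\<And>k. 0 < g k" "backlog g y z n \<le> g (int n + 1)" "n < j"
  shows "backlog g y z j = 0"
  using assms(3)
proof (induction j)
  case (Suc j)
  show ?case
  proof (cases "j = n")
    case True
    then show ?thesis using assms(2) by simp
  next
    case False
    then have "backlog g y z j = 0" using Suc by simp
    then show ?thesis using assms(1)[of "int j + 1"] by simp
  qed
qed simp

text \<open>A backlog that outlasts the gap loses the gap and gains \<open>y\<close>; any other
  loses all of itself. The additive form in \<open>ennreal\<close> can be integrated without knowing
  that anything is finite.\<close>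

lemma backlog_balance:
  assumes "\<And>k. 0 < g k" "\<And>k. 0 \<le> y k" "0 \<le> z"
  shows "ennreal (backlog g y z n) + (\<Sum>j<n. ennreal (min (backlog g y z j) (g (int j + 1)))) =
    ennreal z + (\<Sum>j<n. if g (int j + 1) < backlog g y z j then ennreal (y (int j + 1)) else 0)"
proof (induction n)
  case (Suc n)
  let ?Z = "backlog g y z"
  have nonneg: "0 \<le> ?Z n" by (rule backlog_nonneg) (use assms in auto)
  have step: "ennreal (?Z (Suc n)) + ennreal (min (?Z n) (g (int n + 1))) =
      ennreal (?Z n) + (if g (int n + 1) < ?Z n then ennreal (y (int n + 1)) else 0)"
    using nonneg assms(1)[of "int n + 1"] assms(2)[of "int n + 1"]
    by (auto simp: ennreal_plus[symmetric] min_def simp del: ennreal_plus)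
  have "a + (S + b) = z' + (A + d)" if "a + b = c + d" "c + S = z' + A" for a b c d S A z' :: ennreal
  proof -
    have "a + (S + b) = (a + b) + S" by (simp only: ac_simps)
    also have "\<dots> = (c + S) + d" unfolding that(1) by (simp only: ac_simps)
    also have "\<dots> = z' + (A + d)" unfolding that(2) by (simp only: ac_simps)
    finally show ?thesis .
  qed
  from this[OF step Suc] show ?case
    by (simp only: sum.lessThan_Suc)
qed simp

lemma clearing_time_eq:
  assumes g: "\<And>k. 0 < g k" and n: "backlog g y z n \<le> g (int n + 1)"
    and less: "\<And>j. j < n \<Longrightarrow> g (int j + 1) < backlog g y z j" and nonneg: "0 \<le> backlog g y z n"
  shows "clearing_time g y z = ennreal ((\<Sum>j<n. g (int j + 1)) + backlog g y z n)"
proof -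
  let ?f = "\<lambda>j. min (backlog g y z j) (g (int j + 1))"
  have "clearing_time g y z = (\<Sum>j<Suc n. ennreal (?f j))"
    unfolding clearing_time_def
  proof (rule suminf_finite)
    fix j assume "j \<notin> {..<Suc n}"
    then have "backlog g y z j = 0" using backlog_eq_0[OF g n] by simp
    then show "ennreal (?f j) = 0" using g[of "int j + 1"] by simp
  qed simp
  also have "\<dots> = ennreal (\<Sum>j<Suc n. ?f j)"
  proof (rule sum_ennreal)
    fix j assume "j \<in> {..<Suc n}"
    then show "0 \<le> ?f j" using less[of j] g[of "int j + 1"] nonneg by (cases "j = n") auto
  qed
  also have "(\<Sum>j<n. ?f j) = (\<Sum>j<n. g (int j + 1))"
    using less by (intro sum.cong) (auto simp: less_imp_le)
  then have "(\<Sum>j<Suc n. ?f j) = (\<Sum>j<n. g (int j + 1)) + backlog g y z n"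
    using n by simp
  finally show ?thesis .
qed

section \<open>Schedules follow the workload and backlog recursions\<close>

context one_bit_path
begin

definition gap :: "int \<Rightarrow> real" where "gap k = arr k - arr (k - 1)"

lemma gap_pos: "0 < gap k"
  by (simp add: gap_def)

lemma sz_pos: "0 < sz k"
  using c1_nonneg sz_gt[of k] by linarith

text \<open>The run starts with job \<open>- int m\<close>, so \<open>Suc n\<close> jobs have
  arrived when job \<open>int n - int m\<close> does. Between arrivals \<open>total_work\<close>
  supplies the truncated decrease in the recursion for \<open>workload\<close>.\<close>

lemma work_at_arrival:
  assumes "n \<le> m"
  shows "(\<forall>k\<in>{- int m..int n - int m}. age k (arr (int n - int m)) \<in> {0..sz k}) \<and>
    (\<Sum>k\<in>{- int m..int n - int m}. sz k - age k (arr (int n - int m))) =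
      workload gap sz (Suc n) (int n - int m)"
proof (induction n)
  case 0
  have "max 0 (- gap (- int m)) = 0" using gap_pos[of "- int m"] by simp
  then show ?case using sz_pos[of "- int m"] by (simp add: age_before)
next
  case (Suc n)
  define i where "i = int n - int m"
  have eq: "int (Suc n) - int m = i + 1" "- int m \<le> i + 1" by (simp_all add: i_def)
  have set: "{- int m..i + 1} = insert (i + 1) {- int m..i}" by (auto simp: i_def)
  from Suc.IH have start: "\<And>k. k \<in> {- int m..i} \<Longrightarrow> age k (arr i) \<in> {0..sz k}"
    and work: "(\<Sum>k\<in>{- int m..i}. sz k - age k (arr i)) = workload gap sz (Suc n) i"
    unfolding i_def by blast+
  have t: "arr (i + 1) \<in> {arr i..arr (i + 1)}" by simp
  note tw = total_work[OF t start]
  have new: "age (i + 1) (arr (i + 1)) = 0" by (rule age_before[OF eq(2)]) simp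
  have "(\<Sum>k\<in>{- int m..i + 1}. sz k - age k (arr (i + 1))) = workload gap sz (Suc (Suc n)) (i + 1)"
    unfolding set using tw(2) by (simp add: new work gap_def del: workload.simps(2))
      (simp add: gap_def)
  moreover have "age k (arr (i + 1)) \<in> {0..sz k}" if "k \<in> {- int m..i + 1}" for k
    using that tw(1)[of k] new sz_pos[of "i + 1"] unfolding set by auto
  ultimately show ?case unfolding eq by blast
qed

abbreviation tagged_backlog :: "nat \<Rightarrow> real" where
  "tagged_backlog \<equiv> backlog gap target (workload gap sz (Suc m) 0)"

lemma target_nonneg: "0 \<le> target k"
  using c1_nonneg sz_pos[of k] by (simp add: target_def)

text \<open>Induction along the arrivals that occur before the backlog is cleared. On each gap
  \<open>priority_work\<close> cannot reach the completion of job 0, since the gap is shorter than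
  the backlog; the last clause restores its hypothesis \<open>before\<close> at the next
  arrival.\<close>

lemma backlog_at_arrival:
  assumes long: "\<not> pred 0"
    and "\<And>j. j < n \<Longrightarrow> gap (int j + 1) < tagged_backlog j"
  shows "(\<forall>k\<in>{- int m..int n}. age k (arr (int n)) \<in> {0..target k}) \<and>
    (\<Sum>k\<in>{- int m..int n}. target k - age k (arr (int n))) = tagged_backlog n \<and>
    (\<forall>t\<in>{arr 0..arr (int n)}. age 0 t < sz 0) \<and>
    (\<forall>k\<in>{- int m..<0}. c1 < age 0 (arr (int n)) \<longrightarrow> age k (arr (int n)) = sz k)"
  using assms(2)
proof (induction n)
  case 0
  have age0: "age 0 (arr 0) = 0" by (rule age_before) auto
  from work_at_arrival[of m] have *: "\<And>k. k \<in> {- int m..0} \<Longrightarrow> age k (arr 0) \<in> {0..sz k}"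
    "(\<Sum>k\<in>{- int m..0}. sz k - age k (arr 0)) = workload gap sz (Suc m) 0"
    by auto
  have target: "target k = sz k" if "k \<in> {- int m..0}" for k
    using that by (simp add: target_def)
  have "(\<Sum>k\<in>{- int m..0}. target k - age k (arr 0)) = workload gap sz (Suc m) 0"
    unfolding *(2)[symmetric] by (intro sum.cong) (auto simp: target)
  moreover have "\<forall>k\<in>{- int m..0}. age k (arr 0) \<in> {0..target k}"
    using *(1) target by metis
  ultimately show ?case
    using age0 sz_pos[of 0] c1_nonneg by simp
next
  case (Suc n)
  define i where "i = int n"
  define Z where "Z = tagged_backlog n"
  have eq: "int (Suc n) = i + 1" "- int m \<le> i + 1" "0 \<le> i" by (simp_all add: i_def)
  have set: "{- int m..i + 1} = insert (i + 1) {- int m..i}" by (auto simp: i_def)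
  have "(\<forall>k\<in>{- int m..i}. age k (arr i) \<in> {0..target k}) \<and>
    (\<Sum>k\<in>{- int m..i}. target k - age k (arr i)) = Z \<and>
    (\<forall>t\<in>{arr 0..arr i}. age 0 t < sz 0) \<and>
    (\<forall>k\<in>{- int m..<0}. c1 < age 0 (arr i) \<longrightarrow> age k (arr i) = sz k)"
    unfolding i_def Z_def by (rule Suc.IH) (use Suc.prems in simp)
  then have start: "\<And>k. k \<in> {- int m..i} \<Longrightarrow> age k (arr i) \<in> {0..target k}"
    and work: "(\<Sum>k\<in>{- int m..i}. target k - age k (arr i)) = Z"
    and less: "\<And>t. t \<in> {arr 0..arr i} \<Longrightarrow> age 0 t < sz 0"
    and before: "\<And>k. k \<in> {- int m..<0} \<Longrightarrow> c1 < age 0 (arr i) \<Longrightarrow> age k (arr i) = sz k"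
    by blast+
  have gap: "gap (i + 1) < Z" using Suc.prems[of n] by (simp add: i_def Z_def)
  then have within: "arr (i + 1) < arr i + Z" by (simp add: gap_def)
  have less0: "age 0 (arr i) < sz 0" using less[of "arr i"] eq(3) by simp
  have pw: "(\<forall>k\<in>{- int m..i}. age k t \<in> {0..target k}) \<and>
     (\<Sum>k\<in>{- int m..i}. target k - age k t) = Z - (t - arr i) \<and> age 0 t < sz 0 \<and>
     (\<forall>k\<in>{- int m..<0}. c1 < age 0 t \<longrightarrow> age k t = sz k)" if t: "t \<in> {arr i..arr (i + 1)}" for t
  proof -
    have t': "t \<in> {arr i..min (arr (i + 1)) (arr i + (\<Sum>k\<in>{- int m..i}. target k - age k (arr i)))}"
      using t within work by auto
    note p = priority_work[OF eq(3) long start less0 before t']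
    have "age 0 t \<noteq> sz 0" using p(3) t within work by auto
    moreover have "age 0 t \<le> sz 0" using p(1)[of 0] eq(3) by simp
    ultimately show ?thesis using p(1,2,4) work by (intro conjI ballI impI) auto
  qed
  have new: "age (i + 1) (arr (i + 1)) = 0" by (rule age_before[OF eq(2)]) simp
  have t1: "arr (i + 1) \<in> {arr i..arr (i + 1)}" by simp
  have "(\<Sum>k\<in>{- int m..i + 1}. target k - age k (arr (i + 1))) = Z - gap (i + 1) + target (i + 1)"
    unfolding set using pw[OF t1] by (simp add: new gap_def)
  also have "\<dots> = tagged_backlog (Suc n)"
    using gap by (simp add: Z_def i_def)
  finally have "(\<Sum>k\<in>{- int m..i + 1}. target k - age k (arr (i + 1))) = tagged_backlog (Suc n)" .
  moreover have "age k (arr (i + 1)) \<in> {0..target k}" if "k \<in> {- int m..i + 1}" for k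
    using that pw[OF t1] new target_nonneg[of "i + 1"] unfolding set by auto
  moreover have "age 0 t < sz 0" if "t \<in> {arr 0..arr (i + 1)}" for t
    using that less[of t] pw[of t] by (cases "t \<le> arr i") auto
  ultimately show ?case
    unfolding eq using pw[OF t1] by blast
qed

text \<open>Job 0 completes in the first gap at least as long as the current backlog, exactly when
  that backlog has been worked off. That such a gap exists is a hypothesis here; it is later shown
  to hold almost surely.\<close>

lemma response_time_eq:
  assumes long: "\<not> pred 0" and ex: "\<exists>n. tagged_backlog n \<le> gap (int n + 1)"
  shows "response_time arr sz age 0 = clearing_time gap target (workload gap sz (Suc m) 0)"
proof -
  define n where "n = (LEAST n. tagged_backlog n \<le> gap (int n + 1))"
  have n: "tagged_backlog n \<le> gap (int n + 1)"
    unfolding n_def using ex by (rule LeastI_ex)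
  have less: "gap (int j + 1) < tagged_backlog j" if "j < n" for j
    using not_less_Least[of j "\<lambda>n. tagged_backlog n \<le> gap (int n + 1)"] that
    by (simp add: n_def)
  define i where "i = int n"
  define Z where "Z = tagged_backlog n"
  from backlog_at_arrival[OF long less] have
    start: "\<And>k. k \<in> {- int m..i} \<Longrightarrow> age k (arr i) \<in> {0..target k}"
    and work: "(\<Sum>k\<in>{- int m..i}. target k - age k (arr i)) = Z"
    and inc: "\<And>t. t \<in> {arr 0..arr i} \<Longrightarrow> age 0 t < sz 0"
    and before: "\<And>k. k \<in> {- int m..<0} \<Longrightarrow> c1 < age 0 (arr i) \<Longrightarrow> age k (arr i) = sz k"
    unfolding i_def Z_def by blast+
  have i: "0 \<le> i" by (simp add: i_def)
  have "0 \<le> workload gap sz (Suc m) 0"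
    using sz_pos by (intro workload_nonneg) (simp add: less_imp_le)
  then have Z: "0 \<le> Z" unfolding Z_def by (intro backlog_nonneg target_nonneg)
  have less0: "age 0 (arr i) < sz 0" using inc[of "arr i"] i by simp
  have within: "arr i + Z \<le> arr (i + 1)" using n by (simp add: gap_def Z_def i_def)
  have last: "age 0 t = sz 0 \<longleftrightarrow> t = arr i + Z" if "t \<in> {arr i..arr i + Z}" for t
  proof -
    have t': "t \<in> {arr i..min (arr (i + 1)) (arr i + (\<Sum>k\<in>{- int m..i}. target k - age k (arr i)))}"
      using that within work by auto
    show ?thesis using priority_work(3)[OF i long start less0 before t'] work by simp
  qed
  have total: "(\<Sum>j<k. gap (int j + 1)) = arr (int k) - arr 0" for k
    by (induction k) (simp_all add: gap_def add.commute)
  have sum: "(\<Sum>j<n. gap (int j + 1)) + Z = arr i + Z - arr 0"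
    by (simp add: total i_def)
  have "response_time arr sz age 0 = ennreal (arr i + Z - arr 0)"
    unfolding response_time_def
  proof (rule antisym)
    have "arr 0 \<le> arr i + Z" "age 0 (arr i + Z) = sz 0"
      using i Z last[of "arr i + Z"] by (auto intro: add_increasing2)
    then show "Inf {ennreal (t - arr 0) |t. arr 0 \<le> t \<and> age 0 t = sz 0} \<le> ennreal (arr i + Z - arr 0)"
      by (intro Inf_lower) auto
    show "ennreal (arr i + Z - arr 0) \<le> Inf {ennreal (t - arr 0) |t. arr 0 \<le> t \<and> age 0 t = sz 0}"
    proof (rule Inf_greatest, clarify)
      fix t assume t: "arr 0 \<le> t" "age 0 t = sz 0"
      then have "\<not> t \<le> arr i" using inc[of t] by auto
      then have "arr i + Z \<le> t" using last[of t] t by (cases "t \<le> arr i + Z") auto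
      then show "ennreal (arr i + Z - arr 0) \<le> ennreal (t - arr 0)" by (intro ennreal_leI) simp
    qed
  qed
  also have "\<dots> = clearing_time gap target (workload gap sz (Suc m) 0)"
    using clearing_time_eq[OF gap_pos n less] Z sum
    by (simp only: Z_def)
  finally show ?thesis .
qed

end

subsection \<open>The law of the jobs\<close>

context job_stream
begin

definition exp_law :: "real measure" where
  "exp_law = density lborel (\<lambda>e. ennreal (exponential_density lam e))"

definition svc_law :: "(real \<times> bool) measure" where
  "svc_law = density (lborel \<Otimes>\<^sub>M count_space UNIV)
    (\<lambda>(x, b). ennreal (f x * (if b then p x else 1 - p x)))"

abbreviation job_space :: "(real \<times> real \<times> bool) measure" where
  "job_space \<equiv> borel \<Otimes>\<^sub>M borel \<Otimes>\<^sub>M count_space UNIV"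

definition job :: "int \<Rightarrow> 'w \<Rightarrow> real \<times> real \<times> bool" where
  "job k \<omega> = (gap k \<omega>, svc k \<omega>, short k \<omega>)"

declare f_measurable [measurable] p_measurable [measurable]

lemma job_measurable [measurable]: "job k \<in> measurable M job_space"
  using jobs_indep unfolding indep_vars_def job_def[abs_def] by simp

lemma gap_measurable [measurable]: "gap k \<in> borel_measurable M"
  and svc_measurable [measurable]: "svc k \<in> borel_measurable M"
  and short_measurable [measurable]: "short k \<in> measurable M (count_space UNIV)"
proof -
  have "gap k = (\<lambda>\<omega>. fst (job k \<omega>))" "svc k = (\<lambda>\<omega>. fst (snd (job k \<omega>)))"
    "short k = (\<lambda>\<omega>. snd (snd (job k \<omega>)))" by (auto simp: job_def)
  then show "gap k \<in> borel_measurable M" "svc k \<in> borel_measurable M"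
    "short k \<in> measurable M (count_space UNIV)" by simp_all
qed

lemma sets_exp_law [measurable_cong, simp]: "sets exp_law = sets borel"
  by (simp add: exp_law_def)

lemma sets_svc_law [measurable_cong, simp]: "sets svc_law = sets (borel \<Otimes>\<^sub>M count_space UNIV)"
  unfolding svc_law_def sets_density by (intro sets_pair_measure_cong) simp_all

lemma prob_space_exp_law: "prob_space exp_law"
  unfolding exp_law_def using lam_pos by (rule prob_space_exponential_density)

lemma sigma_finite_count_bool: "sigma_finite_measure (count_space (UNIV :: bool set))"
  by (rule sigma_finite_measure_count_space_finite) simp

lemma nn_integral_svc_law:
  assumes [measurable]: "h \<in> borel_measurable (borel \<Otimes>\<^sub>M count_space UNIV)"
  shows "(\<integral>\<^sup>+ y. h y \<partial>svc_law) =
    (\<integral>\<^sup>+ x. ennreal (f x) * (ennreal (p x) * h (x, True) + ennreal (1 - p x) * h (x, False)) \<partial>lborel)"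
proof -
  interpret sigma_finite_measure "count_space (UNIV :: bool set)" by (rule sigma_finite_count_bool)
  have "(\<integral>\<^sup>+ y. h y \<partial>svc_law) = (\<integral>\<^sup>+ y. (case y of (x, b) \<Rightarrow> ennreal (f x * (if b then p x else 1 - p x))) * h y
      \<partial>(lborel \<Otimes>\<^sub>M count_space UNIV))"
    unfolding svc_law_def by (rule nn_integral_density) auto
  also have "\<dots> = (\<integral>\<^sup>+ x. \<integral>\<^sup>+ b. ennreal (f x * (if b then p x else 1 - p x)) * h (x, b) \<partial>count_space UNIV \<partial>lborel)"
    by (subst nn_integral_fst[symmetric]) auto
  also have "\<dots> = (\<integral>\<^sup>+ x. ennreal (f x) * (ennreal (p x) * h (x, True) + ennreal (1 - p x) * h (x, False)) \<partial>lborel)"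
    using f_nonneg p_range
    by (intro nn_integral_cong)
      (simp add: nn_integral_count_space_finite UNIV_bool ennreal_mult distrib_left mult_ac)
  finally show ?thesis .
qed

lemma nn_integral_svc_law_fst:
  assumes [measurable]: "h \<in> borel_measurable borel"
  shows "(\<integral>\<^sup>+ y. h (fst y) \<partial>svc_law) = (\<integral>\<^sup>+ x. ennreal (f x) * h x \<partial>lborel)"
proof (subst nn_integral_svc_law, measurable, rule nn_integral_cong)
  fix x
  have "ennreal (p x) * h x + ennreal (1 - p x) * h x = ennreal (p x + (1 - p x)) * h x"
    using p_range[of x] by (subst ennreal_plus) (auto simp: distrib_right)
  then show "ennreal (f x) * (ennreal (p x) * h (fst (x, True)) + ennreal (1 - p x) * h (fst (x, False))) =
      ennreal (f x) * h x" by simp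
qed

lemma prob_space_svc_law: "prob_space svc_law"
proof
  show "emeasure svc_law (space svc_law) = 1"
    using nn_integral_svc_law_fst[of "\<lambda>_. 1"] f_total by simp
qed

text \<open>The density splits into a factor in the gap and a factor in the pair of service time and
  bit. That pair stays joint because the bit depends on the service time.\<close>

lemma distr_job: "distr M job_space (job k) = exp_law \<Otimes>\<^sub>M svc_law"
proof -
  let ?L = "lborel \<Otimes>\<^sub>M lborel \<Otimes>\<^sub>M count_space UNIV :: (real \<times> real \<times> bool) measure"
  interpret exp: prob_space exp_law by (rule prob_space_exp_law)
  interpret svc: prob_space svc_law by (rule prob_space_svc_law)
  interpret count: sigma_finite_measure "count_space (UNIV :: bool set)" by (rule sigma_finite_count_bool)
  interpret pair_sigma_finite lborel "count_space (UNIV :: bool set)" ..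
  have "distr M job_space (job k) = distr M ?L (\<lambda>\<omega>. (gap k \<omega>, svc k \<omega>, short k \<omega>))"
    by (intro distr_cong) (auto simp: job_def intro!: sets_pair_measure_cong)
  also have "\<dots> = density ?L (\<lambda>(e, x, b). ennreal (exponential_density lam e * f x * (if b then p x else 1 - p x)))"
    using job_distributed[of k] by (simp add: distributed_def)
  also have "\<dots> = density ?L (\<lambda>(e, y). ennreal (exponential_density lam e) *
      (case y of (x, b) \<Rightarrow> ennreal (f x * (if b then p x else 1 - p x))))"
    using f_nonneg p_range lam_pos
    by (intro arg_cong2[where f=density] refl ext)
       (auto simp: ennreal_mult'[symmetric] exponential_density_def mult.assoc split: prod.splits)
  also have "\<dots> = exp_law \<Otimes>\<^sub>M svc_law"
    unfolding exp_law_def svc_law_def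
    using svc.sigma_finite_measure_axioms sigma_finite_measure_axioms
    by (intro pair_measure_density[symmetric]) (auto simp: svc_law_def)
  finally show ?thesis .
qed

text \<open>An explicit measurable function of the family of jobs up to \<open>k\<close>, the form
  from which independence of job \<open>k + 1\<close> can be read off and which the recursions
  preserve.\<close>

definition past :: "int \<Rightarrow> ('w \<Rightarrow> real) \<Rightarrow> bool" where
  "past k F \<longleftrightarrow> (\<exists>\<phi>\<in>borel_measurable (Pi\<^sub>M {..k} (\<lambda>_. job_space)). F = (\<lambda>\<omega>. \<phi> (\<lambda>i\<in>{..k}. job i \<omega>)))"

lemma past_const: "past k (\<lambda>_. c)"
  unfolding past_def by (intro bexI[of _ "\<lambda>_. c"]) auto

lemma past_step:
  assumes "past k F" and [measurable]: "h \<in> borel_measurable (borel \<Otimes>\<^sub>M job_space)"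
  shows "past (k + 1) (\<lambda>\<omega>. h (F \<omega>, job (k + 1) \<omega>))"
proof -
  from assms(1) obtain \<phi> where [measurable]: "\<phi> \<in> borel_measurable (Pi\<^sub>M {..k} (\<lambda>_. job_space))"
    and F: "F = (\<lambda>\<omega>. \<phi> (\<lambda>i\<in>{..k}. job i \<omega>))" by (auto simp: past_def)
  have [measurable]: "(\<lambda>x. restrict x {..k}) \<in> measurable (Pi\<^sub>M {..k + 1} (\<lambda>_. job_space)) (Pi\<^sub>M {..k} (\<lambda>_. job_space))"
    by (rule measurable_restrict_subset) auto
  have [measurable]: "(\<lambda>x. x (k + 1)) \<in> measurable (Pi\<^sub>M {..k + 1} (\<lambda>_. job_space)) job_space"
    by (rule measurable_component_singleton) simp
  have "{..k + 1} \<inter> {..k} = {..k}" by auto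
  then show ?thesis
    unfolding past_def F
    by (intro bexI[of _ "\<lambda>x. h (\<phi> (restrict x {..k}), x (k + 1))"]) (auto simp: fun_eq_iff)
qed

lemma past_measurable:
  assumes "past k F"
  shows "F \<in> borel_measurable M"
proof -
  from assms obtain \<phi> where [measurable]: "\<phi> \<in> borel_measurable (Pi\<^sub>M {..k} (\<lambda>_. job_space))"
    and F: "F = (\<lambda>\<omega>. \<phi> (\<lambda>i\<in>{..k}. job i \<omega>))" by (auto simp: past_def)
  show ?thesis unfolding F by measurable
qed

text \<open>A function of the jobs up to \<open>k\<close> is independent of job
  \<open>k + 1\<close>, whose gap and service pair can then be integrated out one after the other by
  Tonelli. Every later use of independence goes through this form.\<close>

lemma nn_integral_past_job:
  assumes past: "past k F" and [measurable]: "h \<in> borel_measurable (borel \<Otimes>\<^sub>M job_space)"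
  shows "(\<integral>\<^sup>+ \<omega>. h (F \<omega>, job (k + 1) \<omega>) \<partial>M) =
    (\<integral>\<^sup>+ \<omega>. \<integral>\<^sup>+ e. \<integral>\<^sup>+ y. h (F \<omega>, e, y) \<partial>svc_law \<partial>exp_law \<partial>M)"
proof -
  interpret exp: prob_space exp_law by (rule prob_space_exp_law)
  interpret svc: prob_space svc_law by (rule prob_space_svc_law)
  interpret pair: pair_prob_space exp_law svc_law ..
  from past obtain \<phi> where [measurable]: "\<phi> \<in> borel_measurable (Pi\<^sub>M {..k} (\<lambda>_. job_space))"
    and F: "F = (\<lambda>\<omega>. \<phi> (\<lambda>i\<in>{..k}. job i \<omega>))" by (auto simp: past_def)
  note [measurable] = past_measurable[OF past]
  \<comment> \<open>\<open>indep_var\<close> needs both variables to have the same type.\<close>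
  define F' where "F' \<omega> = (F \<omega>, 0 :: real, True)" for \<omega>
  have [measurable]: "F' \<in> measurable M job_space" unfolding F'_def by measurable
  have "indep_vars (\<lambda>_. job_space) job UNIV"
    using jobs_indep by (simp add: job_def[abs_def])
  then have "indep_var (Pi\<^sub>M {..k} (\<lambda>_. job_space)) (\<lambda>\<omega>. \<lambda>i\<in>{..k}. job i \<omega>)
      (Pi\<^sub>M {k + 1} (\<lambda>_. job_space)) (\<lambda>\<omega>. \<lambda>i\<in>{k + 1}. job i \<omega>)"
    by (rule indep_var_restrict) auto
  then have "indep_var job_space ((\<lambda>x. (\<phi> x, 0, True)) \<circ> (\<lambda>\<omega>. \<lambda>i\<in>{..k}. job i \<omega>))
      job_space ((\<lambda>x. x (k + 1)) \<circ> (\<lambda>\<omega>. \<lambda>i\<in>{k + 1}. job i \<omega>))"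
    by (rule indep_var_compose) (auto intro!: measurable_component_singleton)
  then have "indep_var job_space F' job_space (job (k + 1))"
    by (simp add: F F'_def[abs_def] comp_def)
  then have law: "distr M (job_space \<Otimes>\<^sub>M job_space) (\<lambda>\<omega>. (F' \<omega>, job (k + 1) \<omega>)) =
      distr M job_space F' \<Otimes>\<^sub>M (exp_law \<Otimes>\<^sub>M svc_law)"
    by (simp add: indep_var_distribution_eq distr_job)
  have "(\<integral>\<^sup>+ \<omega>. h (F \<omega>, job (k + 1) \<omega>) \<partial>M) = (\<integral>\<^sup>+ z. h (fst (fst z), snd z)
      \<partial>distr M (job_space \<Otimes>\<^sub>M job_space) (\<lambda>\<omega>. (F' \<omega>, job (k + 1) \<omega>)))"
    by (subst nn_integral_distr) (auto simp: F'_def)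
  also have "\<dots> = (\<integral>\<^sup>+ v. \<integral>\<^sup>+ z. h (fst v, z) \<partial>(exp_law \<Otimes>\<^sub>M svc_law) \<partial>distr M job_space F')"
    unfolding law by (subst pair.nn_integral_fst[symmetric]) auto
  also have "\<dots> = (\<integral>\<^sup>+ v. \<integral>\<^sup>+ e. \<integral>\<^sup>+ y. h (fst v, e, y) \<partial>svc_law \<partial>exp_law \<partial>distr M job_space F')"
    by (intro nn_integral_cong, subst svc.nn_integral_fst[symmetric]) auto
  also have "\<dots> = (\<integral>\<^sup>+ \<omega>. \<integral>\<^sup>+ e. \<integral>\<^sup>+ y. h (F \<omega>, e, y) \<partial>svc_law \<partial>exp_law \<partial>M)"
    by (subst nn_integral_distr) (auto simp: F'_def)
  finally show ?thesis .
qed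

section \<open>Integrals against the exponential law\<close>

lemma nn_integral_exp_law:
  assumes [measurable]: "h \<in> borel_measurable borel"
  shows "(\<integral>\<^sup>+ e. h e \<partial>exp_law) =
    (\<integral>\<^sup>+ e. ennreal (lam * exp (- lam * e)) * h e * indicator {0..} e \<partial>lborel)"
  unfolding exp_law_def
  by (subst nn_integral_density)
    (auto intro!: nn_integral_cong simp: exponential_density_def mult_ac split: split_indicator)

lemma nn_integral_exp_law_piecewise:
  fixes a F :: "real \<Rightarrow> real"
  assumes z: "0 \<le> z" and [measurable]: "a \<in> borel_measurable borel"
    and a: "\<And>e. 0 \<le> e \<Longrightarrow> e \<le> z \<Longrightarrow> 0 \<le> a e" and b: "0 \<le> b"
    and F: "\<And>e. 0 \<le> e \<Longrightarrow> e \<le> z \<Longrightarrow> (F has_real_derivative lam * exp (- lam * e) * a e) (at e)"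
  shows "(\<integral>\<^sup>+ e. ennreal (if e < z then a e else b) \<partial>exp_law) = ennreal (F z - F 0 + b * exp (- lam * z))"
proof -
  \<comment> \<open>The point \<open>z\<close> is counted by both indicators, which is harmless as
    it is a null set.\<close>
  have "(\<integral>\<^sup>+ e. ennreal (if e < z then a e else b) \<partial>exp_law) =
      (\<integral>\<^sup>+ e. ennreal (lam * exp (- lam * e) * a e) * indicator {0..z} e +
        ennreal (lam * exp (- lam * e) * b) * indicator {z..} e \<partial>lborel)"
    by (subst nn_integral_exp_law, measurable, rule nn_integral_cong_AE)
      (use AE_lborel_singleton[of z] lam_pos z in
        \<open>auto elim!: eventually_mono simp: ennreal_mult'[symmetric] split: split_indicator\<close>)
  also have "\<dots> = (\<integral>\<^sup>+ e. ennreal (lam * exp (- lam * e) * a e) * indicator {0..z} e \<partial>lborel) +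
      (\<integral>\<^sup>+ e. ennreal (lam * exp (- lam * e) * b) * indicator {z..} e \<partial>lborel)"
    by (rule nn_integral_add) auto
  also have "(\<integral>\<^sup>+ e. ennreal (lam * exp (- lam * e) * a e) * indicator {0..z} e \<partial>lborel) = ennreal (F z - F 0)"
    using z a lam_pos by (intro nn_integral_FTC_Icc F) auto
  also have "(\<integral>\<^sup>+ e. ennreal (lam * exp (- lam * e) * b) * indicator {z..} e \<partial>lborel) =
      ennreal (0 - (- b * exp (- lam * z)))"
  proof (rule nn_integral_FTC_atLeast)
    show "((\<lambda>e. - b * exp (- lam * e)) has_real_derivative lam * exp (- lam * e) * b) (at e)" for e
      by (auto intro!: derivative_eq_intros)
    have "LIM e at_top. - lam * e :> at_bot"
      using lam_pos by (intro filterlim_tendsto_neg_mult_at_bot[OF tendsto_const _ filterlim_ident]) auto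
    then have "((\<lambda>e. exp (- lam * e)) \<longlongrightarrow> 0) at_top"
      by (rule filterlim_compose[OF exp_at_bot])
    then show "((\<lambda>e. - b * exp (- lam * e)) \<longlongrightarrow> 0) at_top"
      using tendsto_mult_right_zero by blast
  qed (use lam_pos b in auto)
  also have "ennreal (F z - F 0) + ennreal (0 - (- b * exp (- lam * z))) = ennreal (F z - F 0 + b * exp (- lam * z))"
  proof -
    have "F 0 \<le> F z"
      using DERIV_nonneg_imp_nondecreasing[OF z, of F] F a lam_pos
      by (metis (no_types, opaque_lifting) exp_ge_zero less_imp_le mult_nonneg_nonneg)
    then show ?thesis using b by (simp add: ennreal_plus)
  qed
  finally show ?thesis .
qed

lemma exp_law_lessThan:
  assumes "0 \<le> z"
  shows "(\<integral>\<^sup>+ e. ennreal (if e < z then 1 else 0) \<partial>exp_law) = ennreal (1 - exp (- lam * z))"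
proof -
  have "((\<lambda>e. - exp (- lam * e)) has_real_derivative lam * exp (- lam * e) * 1) (at e)" for e
    by (auto intro!: derivative_eq_intros)
  from nn_integral_exp_law_piecewise[OF assms _ _ _ this, of 0] show ?thesis by simp
qed

text \<open>The mean of the minimum is the integral of the tail \<open>exp (- lam * e)\<close> from
  0 to \<open>z\<close>. Up to the factor \<open>lam\<close> it agrees with
  \<open>exp_law_lessThan\<close>, and this agreement converts expected arrivals into expected
  time.\<close>

lemma exp_law_min:
  assumes "0 \<le> z"
  shows "(\<integral>\<^sup>+ e. ennreal (min z e) \<partial>exp_law) = ennreal ((1 - exp (- lam * z)) / lam)"
proof -
  have "(\<integral>\<^sup>+ e. ennreal (min z e) \<partial>exp_law) = (\<integral>\<^sup>+ e. ennreal (if e < z then e else z) \<partial>exp_law)"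
    by (intro nn_integral_cong arg_cong[where f=ennreal]) auto
  \<comment> \<open>The antiderivative of \<open>lam * e * exp (- lam * e)\<close> used here is
    \<open>- (e + 1 / lam) * exp (- lam * e)\<close>.\<close>
  also have "\<dots> = ennreal (- (z + 1 / lam) * exp (- lam * z) - - (0 + 1 / lam) * exp (- lam * 0) + z * exp (- lam * z))"
    using assms lam_pos
    by (intro nn_integral_exp_law_piecewise) (auto intro!: derivative_eq_intros simp: field_simps)
  also have "- (z + 1 / lam) * exp (- lam * z) - - (0 + 1 / lam) * exp (- lam * 0) + z * exp (- lam * z) =
      (1 - exp (- lam * z)) / lam"
    using lam_pos by (simp add: field_simps)
  finally show ?thesis .
qed

text \<open>One Lindley step from work \<open>v\<close>, in the Laplace transform. Without
  truncation at 0 it would multiply \<open>exp (- \<theta> * v)\<close> by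
  \<open>lam / (lam - \<theta>)\<close>, finite for \<open>\<theta> < lam\<close>; the term with
  \<open>exp (- lam * v)\<close> corrects for the truncation.\<close>

lemma exp_law_laplace:
  assumes "0 \<le> v" "0 \<le> \<theta>" "\<theta> < lam"
  shows "(\<integral>\<^sup>+ e. ennreal (exp (- \<theta> * max 0 (v - e))) \<partial>exp_law) =
    ennreal ((lam * exp (- \<theta> * v) - \<theta> * exp (- lam * v)) / (lam - \<theta>))"
proof -
  have "(\<integral>\<^sup>+ e. ennreal (exp (- \<theta> * max 0 (v - e))) \<partial>exp_law) =
      (\<integral>\<^sup>+ e. ennreal (if e < v then exp (- \<theta> * (v - e)) else 1) \<partial>exp_law)"
    by (intro nn_integral_cong arg_cong[where f=ennreal]) auto
  also have "\<dots> = ennreal (- (lam / (lam - \<theta>)) * exp (- \<theta> * v - (lam - \<theta>) * v) -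
      - (lam / (lam - \<theta>)) * exp (- \<theta> * v - (lam - \<theta>) * 0) + 1 * exp (- lam * v))"
  proof (rule nn_integral_exp_law_piecewise)
    fix e
    have "((\<lambda>e. - (lam / (lam - \<theta>)) * exp (- \<theta> * v - (lam - \<theta>) * e)) has_real_derivative
        - (lam / (lam - \<theta>)) * (exp (- \<theta> * v - (lam - \<theta>) * e) * (- (lam - \<theta>)))) (at e)"
      using \<open>\<theta> < lam\<close> by (auto intro!: derivative_eq_intros)
    also have "- (lam / (lam - \<theta>)) * (x * (- (lam - \<theta>))) = lam * x" for x
      using \<open>\<theta> < lam\<close> by (simp add: field_simps)
    also have "lam * exp (- \<theta> * v - (lam - \<theta>) * e) = lam * exp (- lam * e) * exp (- \<theta> * (v - e))"
      by (simp add: mult.assoc exp_add[symmetric] algebra_simps)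
    finally show "((\<lambda>e. - (lam / (lam - \<theta>)) * exp (- \<theta> * v - (lam - \<theta>) * e)) has_real_derivative
        lam * exp (- lam * e) * exp (- \<theta> * (v - e))) (at e)" .
  qed (use assms in auto)
  also have "- (lam / (lam - \<theta>)) * exp (- \<theta> * v - (lam - \<theta>) * v) -
      - (lam / (lam - \<theta>)) * exp (- \<theta> * v - (lam - \<theta>) * 0) + 1 * exp (- lam * v) =
      (lam * exp (- \<theta> * v) - \<theta> * exp (- lam * v)) / (lam - \<theta>)"
    using assms by (simp add: divide_simps) (simp add: algebra_simps)
  finally show ?thesis .
qed

subsection \<open>The expected clearing time\<close>

lemma AE_gap_pos: "AE \<omega> in M. 0 < gap k \<omega>" and AE_svc_pos: "AE \<omega> in M. 0 < svc k \<omega>"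
proof -
  have "past (k - 1) (\<lambda>_. 0)" by (rule past_const)
  note int = nn_integral_past_job[OF this, simplified]
  have "(\<integral>\<^sup>+ \<omega>. indicator {..0} (gap k \<omega>) \<partial>M) = (\<integral>\<^sup>+ e. indicator {..0} e \<partial>exp_law)"
    using int[of "\<lambda>z. indicator {..0} (fst (snd z))"] prob_space.emeasure_space_1[OF prob_space_svc_law]
    by (simp add: job_def emeasure_space_1)
  also have "\<dots> = (\<integral>\<^sup>+ e. 0 \<partial>(lborel :: real measure))"
    by (subst nn_integral_exp_law, measurable, rule nn_integral_cong_AE)
      (use AE_lborel_singleton[of 0] in \<open>auto elim!: eventually_mono split: split_indicator\<close>)
  finally have "AE \<omega> in M. indicator {..0} (gap k \<omega>) = (0 :: ennreal)"
    by (subst nn_integral_0_iff_AE[symmetric]) auto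
  then show "AE \<omega> in M. 0 < gap k \<omega>"
    by (auto elim!: eventually_mono split: split_indicator_asm)
  have "(\<integral>\<^sup>+ \<omega>. indicator {..0} (svc k \<omega>) \<partial>M) = (\<integral>\<^sup>+ y. indicator {..0} (fst y) \<partial>svc_law)"
    using int[of "\<lambda>z. indicator {..0} (fst (snd (snd z)))"] prob_space.emeasure_space_1[OF prob_space_exp_law]
    by (simp add: job_def emeasure_space_1)
  also have "\<dots> = (\<integral>\<^sup>+ x. 0 \<partial>(lborel :: real measure))"
    by (subst nn_integral_svc_law_fst, measurable, rule nn_integral_cong)
      (use f_support in \<open>auto split: split_indicator\<close>)
  finally have "AE \<omega> in M. indicator {..0} (svc k \<omega>) = (0 :: ennreal)"
    by (subst nn_integral_0_iff_AE[symmetric]) auto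
  then show "AE \<omega> in M. 0 < svc k \<omega>"
    by (auto elim!: eventually_mono split: split_indicator_asm)
qed

lemma AE_pos: "AE \<omega> in M. (\<forall>k. 0 < gap k \<omega>) \<and> (\<forall>k. 0 < svc k \<omega>)"
  using AE_gap_pos AE_svc_pos by (simp add: AE_all_countable)

text \<open>The service that a job arriving after a long tagged job receives before that job completes.\<close>

definition ahead :: "real \<Rightarrow> 'w \<Rightarrow> int \<Rightarrow> real" where
  "ahead c1 \<omega> k = (if short k \<omega> then c1 + svc k \<omega> else c1)"

lemma ahead_measurable [measurable]: "(\<lambda>\<omega>. ahead c1 \<omega> k) \<in> borel_measurable M"
  unfolding ahead_def by measurable

text \<open>Averaging over the bit gives \<open>c1 + p x * x\<close> for service time
  \<open>x\<close>, so \<open>rho_new\<close> is \<open>lam\<close> times the mean of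
  \<open>ahead\<close>.\<close>

lemma rho_new_eq:
  assumes "0 \<le> c1"
  shows "rho_new lam c1 f p =
    ennreal lam * (\<integral>\<^sup>+ y. ennreal (if snd y then c1 + fst y else c1) \<partial>svc_law)"
proof -
  have "(\<integral>\<^sup>+ y. ennreal (if snd y then c1 + fst y else c1) \<partial>svc_law) =
      (\<integral>\<^sup>+ x. ennreal c1 * ennreal (f x) + ennreal (p x * x * f x) * indicator {0<..} x \<partial>lborel)"
  proof (subst nn_integral_svc_law, measurable, rule nn_integral_cong)
    fix x
    show "ennreal (f x) * (ennreal (p x) * ennreal (if snd (x, True) then c1 + fst (x, True) else c1) +
        ennreal (1 - p x) * ennreal (if snd (x, False) then c1 + fst (x, False) else c1)) =
      ennreal c1 * ennreal (f x) + ennreal (p x * x * f x) * indicator {0<..} x"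
    proof (cases "0 < x")
      case True
      have "f x * (p x * (c1 + x) + (1 - p x) * c1) = c1 * f x + p x * x * f x"
        by (simp add: algebra_simps)
      then show ?thesis
        using True assms p_range[of x] f_nonneg[of x]
        by (simp add: ennreal_mult'[symmetric] ennreal_plus[symmetric] del: ennreal_plus)
    qed (simp add: f_support)
  qed
  also have "\<dots> = ennreal c1 * (\<integral>\<^sup>+ x. ennreal (f x) \<partial>lborel) +
      (\<integral>\<^sup>+ x. ennreal (p x * x * f x) * indicator {0<..} x \<partial>lborel)"
    by (subst nn_integral_add) (auto simp: nn_integral_cmult)
  finally show ?thesis
    by (simp add: rho_new_def f_total)
qed

lemma past_backlog:
  assumes "past 0 F"
  shows "past (int n) (\<lambda>\<omega>. backlog (\<lambda>k. gap k \<omega>) (ahead c1 \<omega>) (F \<omega>) n)"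
proof (induction n)
  case 0
  then show ?case using assms by simp
next
  case (Suc n)
  let ?h = "\<lambda>(z, e, x, b). if e < z then z - e + (if b then c1 + x else c1) else 0 :: real"
  have "?h \<in> borel_measurable (borel \<Otimes>\<^sub>M job_space)" by measurable
  from past_step[OF Suc this] show ?case
    by (simp add: job_def ahead_def add.commute cong: if_cong)
qed

text \<open>Given \<open>Z\<close>, the probability that the next gap is shorter and
  \<open>lam\<close> times the mean of its minimum with \<open>Z\<close> are both
  \<open>1 - exp (- lam * Z)\<close>. The contribution of the arriving job is independent of
  \<open>Z\<close> and of the gap, so its mean factors out. This is the Wald identity for a single
  gap.\<close>

lemma nn_integral_backlog_step:
  assumes past: "past k Z" and nonneg: "AE \<omega> in M. 0 \<le> Z \<omega>" and c1: "0 \<le> c1"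
  shows "ennreal lam * (\<integral>\<^sup>+ \<omega>. ennreal (min (Z \<omega>) (gap (k + 1) \<omega>)) \<partial>M) =
      (\<integral>\<^sup>+ \<omega>. (if gap (k + 1) \<omega> < Z \<omega> then 1 else 0) \<partial>M)"
    and "ennreal lam * (\<integral>\<^sup>+ \<omega>. (if gap (k + 1) \<omega> < Z \<omega> then ennreal (ahead c1 \<omega> (k + 1)) else 0) \<partial>M) =
      rho_new lam c1 f p * (\<integral>\<^sup>+ \<omega>. (if gap (k + 1) \<omega> < Z \<omega> then 1 else 0) \<partial>M)"
proof -
  note [measurable] = past_measurable[OF past]
  have svc1: "emeasure svc_law (space svc_law) = 1"
    using prob_space.emeasure_space_1[OF prob_space_svc_law] .
  have if1: "(if P then 1 else 0 :: ennreal) = ennreal (if P then 1 else 0)" for P by simp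
  have "(\<integral>\<^sup>+ \<omega>. ennreal (min (Z \<omega>) (gap (k + 1) \<omega>)) \<partial>M) =
      (\<integral>\<^sup>+ \<omega>. \<integral>\<^sup>+ e. ennreal (min (Z \<omega>) e) \<partial>exp_law \<partial>M)"
    using nn_integral_past_job[OF past, of "\<lambda>(z, e, y). ennreal (min z e)"] svc1
    by (simp add: job_def)
  also have "\<dots> = (\<integral>\<^sup>+ \<omega>. ennreal ((1 - exp (- lam * Z \<omega>)) / lam) \<partial>M)"
    using nonneg by (intro nn_integral_cong_AE) (auto elim!: eventually_mono simp: exp_law_min)
  finally have *: "ennreal lam * (\<integral>\<^sup>+ \<omega>. ennreal (min (Z \<omega>) (gap (k + 1) \<omega>)) \<partial>M) =
      (\<integral>\<^sup>+ \<omega>. ennreal (1 - exp (- lam * Z \<omega>)) \<partial>M)"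
    using lam_pos
    by (simp only:) (subst nn_integral_cmult[symmetric], auto simp: ennreal_mult'[symmetric])
  have "(\<integral>\<^sup>+ \<omega>. (if gap (k + 1) \<omega> < Z \<omega> then 1 else 0) \<partial>M) =
      (\<integral>\<^sup>+ \<omega>. \<integral>\<^sup>+ e. ennreal (if e < Z \<omega> then 1 else 0) \<partial>exp_law \<partial>M)"
    using nn_integral_past_job[OF past, of "\<lambda>(z, e, y). ennreal (if e < z then 1 else 0)"] svc1
    by (simp add: job_def if1 del: ennreal_eq_1 ennreal_1 cong: if_cong)
  also have "\<dots> = (\<integral>\<^sup>+ \<omega>. ennreal (1 - exp (- lam * Z \<omega>)) \<partial>M)"
    using nonneg by (intro nn_integral_cong_AE) (auto elim!: eventually_mono simp: exp_law_lessThan)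
  finally have P: "(\<integral>\<^sup>+ \<omega>. (if gap (k + 1) \<omega> < Z \<omega> then 1 else 0) \<partial>M) =
      (\<integral>\<^sup>+ \<omega>. ennreal (1 - exp (- lam * Z \<omega>)) \<partial>M)" .
  with * show "ennreal lam * (\<integral>\<^sup>+ \<omega>. ennreal (min (Z \<omega>) (gap (k + 1) \<omega>)) \<partial>M) =
      (\<integral>\<^sup>+ \<omega>. (if gap (k + 1) \<omega> < Z \<omega> then 1 else 0) \<partial>M)" by simp
  have if_mult: "ennreal (if P then 1 else 0) * x = (if P then x else 0)" for P and x :: ennreal
    by simp
  let ?Y = "\<lambda>y. ennreal (if snd y then c1 + fst y else c1)"
  have "(\<integral>\<^sup>+ \<omega>. (if gap (k + 1) \<omega> < Z \<omega> then ennreal (ahead c1 \<omega> (k + 1)) else 0) \<partial>M) =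
      (\<integral>\<^sup>+ \<omega>. \<integral>\<^sup>+ e. \<integral>\<^sup>+ y. ennreal (if e < Z \<omega> then 1 else 0) * ?Y y \<partial>svc_law \<partial>exp_law \<partial>M)"
    using nn_integral_past_job[OF past, of "\<lambda>(z, e, y). ennreal (if e < z then 1 else 0) * ?Y y"]
    by (simp add: job_def ahead_def if_mult cong: if_cong)
  also have "\<dots> = (\<integral>\<^sup>+ \<omega>. (\<integral>\<^sup>+ e. ennreal (if e < Z \<omega> then 1 else 0) \<partial>exp_law) * (\<integral>\<^sup>+ y. ?Y y \<partial>svc_law) \<partial>M)"
    by (simp add: nn_integral_cmult nn_integral_multc)
  also have "\<dots> = (\<integral>\<^sup>+ \<omega>. ennreal (1 - exp (- lam * Z \<omega>)) * (\<integral>\<^sup>+ y. ?Y y \<partial>svc_law) \<partial>M)"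
    using nonneg by (intro nn_integral_cong_AE) (auto elim!: eventually_mono simp: exp_law_lessThan)
  also have "\<dots> = (\<integral>\<^sup>+ \<omega>. ennreal (1 - exp (- lam * Z \<omega>)) \<partial>M) * (\<integral>\<^sup>+ y. ?Y y \<partial>svc_law)"
    by (rule nn_integral_multc) auto
  finally show "ennreal lam * (\<integral>\<^sup>+ \<omega>. (if gap (k + 1) \<omega> < Z \<omega> then ennreal (ahead c1 \<omega> (k + 1)) else 0) \<partial>M) =
      rho_new lam c1 f p * (\<integral>\<^sup>+ \<omega>. (if gap (k + 1) \<omega> < Z \<omega> then 1 else 0) \<partial>M)"
    by (simp add: P rho_new_eq[OF c1] mult_ac)
qed

text \<open>The integrated balance reads: mean of \<open>Z n\<close> plus \<open>t n\<close> equals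
  \<open>m0 + \<rho> * t n\<close>, where \<open>t n\<close> is the expected time worked in the
  first \<open>n\<close> gaps. It bounds \<open>t n\<close>, hence the expected number of gaps
  outlasted, so the backlog is cleared almost surely. Then the balance passes to the limit and
  \<open>T = m0 + \<rho> * T\<close> determines the mean.\<close>

lemma nn_integral_clearing_time:
  assumes past: "past 0 F" and nonneg: "AE \<omega> in M. 0 \<le> F \<omega>" and c1: "0 \<le> c1"
    and finite: "(\<integral>\<^sup>+ \<omega>. ennreal (F \<omega>) \<partial>M) < \<infinity>" and rho: "rho_new lam c1 f p < 1"
  defines "Z \<equiv> \<lambda>n \<omega>. backlog (\<lambda>k. gap k \<omega>) (ahead c1 \<omega>) (F \<omega>) n"
  shows "AE \<omega> in M. \<exists>n. Z n \<omega> \<le> gap (int n + 1) \<omega>"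
    and "(\<integral>\<^sup>+ \<omega>. clearing_time (\<lambda>k. gap k \<omega>) (ahead c1 \<omega>) (F \<omega>) \<partial>M) =
      (\<integral>\<^sup>+ \<omega>. ennreal (F \<omega>) \<partial>M) / (1 - rho_new lam c1 f p)"
proof -
  have past_Z: "past (int n) (Z n)" for n
    unfolding Z_def by (rule past_backlog[OF past])
  note [measurable] = past_measurable[OF past] past_measurable[OF past_Z]
  have pos: "AE \<omega> in M. (\<forall>k. 0 < gap k \<omega>) \<and> (\<forall>k. 0 \<le> ahead c1 \<omega> k) \<and> 0 \<le> F \<omega>"
    using AE_pos nonneg by eventually_elim (use c1 in \<open>auto simp: ahead_def less_imp_le\<close>)
  have Z_nonneg: "AE \<omega> in M. 0 \<le> Z n \<omega>" for n
    using pos by eventually_elim (auto simp: Z_def intro!: backlog_nonneg)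
  define mins where "mins n \<omega> = ennreal (min (Z n \<omega>) (gap (int n + 1) \<omega>))" for n \<omega>
  define adds where "adds n \<omega> = (if gap (int n + 1) \<omega> < Z n \<omega> then ennreal (ahead c1 \<omega> (int n + 1)) else 0)"
    for n \<omega>
  define busy where "busy n \<omega> = (if gap (int n + 1) \<omega> < Z n \<omega> then 1 else 0 :: ennreal)" for n \<omega>
  have [measurable]: "mins n \<in> borel_measurable M" "adds n \<in> borel_measurable M" "busy n \<in> borel_measurable M" for n
    unfolding mins_def[abs_def] adds_def[abs_def] busy_def[abs_def] by measurable
  define \<rho> where "\<rho> = rho_new lam c1 f p"
  have mins: "ennreal lam * (\<integral>\<^sup>+ \<omega>. mins n \<omega> \<partial>M) = (\<integral>\<^sup>+ \<omega>. busy n \<omega> \<partial>M)" for n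
    using nn_integral_backlog_step(1)[OF past_Z Z_nonneg c1] by (simp add: mins_def busy_def)
  have "ennreal lam * (\<integral>\<^sup>+ \<omega>. adds n \<omega> \<partial>M) = ennreal lam * (\<rho> * (\<integral>\<^sup>+ \<omega>. mins n \<omega> \<partial>M))" for n
  proof -
    have "ennreal lam * (\<integral>\<^sup>+ \<omega>. adds n \<omega> \<partial>M) = \<rho> * (\<integral>\<^sup>+ \<omega>. busy n \<omega> \<partial>M)"
      using nn_integral_backlog_step(2)[OF past_Z Z_nonneg c1, of n]
      by (simp add: adds_def busy_def \<rho>_def)
    then show ?thesis by (simp only: mins[symmetric] mult_ac)
  qed
  then have adds: "(\<integral>\<^sup>+ \<omega>. adds n \<omega> \<partial>M) = \<rho> * (\<integral>\<^sup>+ \<omega>. mins n \<omega> \<partial>M)" for n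
    using lam_pos by (simp add: ennreal_mult_cancel_left)
  define t where "t n = (\<Sum>j<n. \<integral>\<^sup>+ \<omega>. mins j \<omega> \<partial>M)" for n
  define m0 where "m0 = (\<integral>\<^sup>+ \<omega>. ennreal (F \<omega>) \<partial>M)"
  have balance: "(\<integral>\<^sup>+ \<omega>. ennreal (Z n \<omega>) \<partial>M) + t n = m0 + \<rho> * t n" for n
  proof -
    have "(\<integral>\<^sup>+ \<omega>. ennreal (Z n \<omega>) + (\<Sum>j<n. mins j \<omega>) \<partial>M) = (\<integral>\<^sup>+ \<omega>. ennreal (F \<omega>) + (\<Sum>j<n. adds j \<omega>) \<partial>M)"
    proof (rule nn_integral_cong_AE, use pos in eventually_elim)
      case (elim \<omega>)
      then show ?case
        unfolding Z_def mins_def adds_def by (intro backlog_balance) auto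
    qed
    then show ?thesis
      by (simp add: nn_integral_add nn_integral_sum adds t_def m0_def sum_distrib_left)
  qed
  obtain r where r: "\<rho> = ennreal r" "0 \<le> r" "r < 1"
    using rho by (cases \<rho>) (auto simp: \<rho>_def ennreal_less_one_iff)
  obtain m where m: "m0 = ennreal m" "0 \<le> m"
    using finite by (cases m0) (auto simp: m0_def)
  have "(\<integral>\<^sup>+ \<omega>. busy n \<omega> \<partial>M) \<le> (\<integral>\<^sup>+ \<omega>. 1 \<partial>M)" for n
    by (intro nn_integral_mono) (simp add: busy_def)
  also have "(\<integral>\<^sup>+ \<omega>. 1 \<partial>M) < \<infinity>"
    by (simp add: emeasure_space_1)
  finally have fin: "ennreal lam * (\<integral>\<^sup>+ \<omega>. mins n \<omega> \<partial>M) < \<infinity>" for n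
    by (simp add: mins)
  have "(\<integral>\<^sup>+ \<omega>. mins n \<omega> \<partial>M) < \<infinity>" for n
    using fin[of n] lam_pos by (auto simp: ennreal_mult_less_top)
  then have t_fin: "t n < \<infinity>" for n
    by (simp add: t_def)
  \<comment> \<open>Drop the mean of \<open>Z n\<close> from the balance. Each gap adds at most
    \<open>1 / lam\<close>, so \<open>t n\<close> is finite and \<open>\<rho> * t n\<close> can be
    subtracted.\<close>
  have t_le: "t n \<le> ennreal (m / (1 - r))" for n
  proof -
    obtain u where u: "t n = ennreal u" "0 \<le> u"
      using t_fin[of n] by (cases "t n") auto
    have "t n \<le> m0 + \<rho> * t n"
      by (subst balance[symmetric]) simp
    then have "u \<le> m + r * u"
      using r m u by (simp add: ennreal_mult'[symmetric] ennreal_plus[symmetric] del: ennreal_plus)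
    then have "u \<le> m / (1 - r)"
      using r by (simp add: field_simps)
    then show ?thesis unfolding u(1) by (rule ennreal_leI)
  qed
  define T where "T = (\<Sum>n. \<integral>\<^sup>+ \<omega>. mins n \<omega> \<partial>M)"
  have "T \<le> ennreal (m / (1 - r))"
    unfolding T_def by (rule suminf_le_const[OF summableI]) (use t_le in \<open>simp add: t_def\<close>)
  then obtain \<tau> where T: "T = ennreal \<tau>" "0 \<le> \<tau>"
    by (cases T) (auto simp: top_unique)
  have "(\<integral>\<^sup>+ \<omega>. (\<Sum>n. busy n \<omega>) \<partial>M) = ennreal lam * T"
    by (simp add: nn_integral_suminf mins[symmetric] T_def ennreal_suminf_cmult)
  then have "(\<integral>\<^sup>+ \<omega>. (\<Sum>n. busy n \<omega>) \<partial>M) \<noteq> \<infinity>"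
    by (simp add: T ennreal_mult_eq_top_iff)
  \<comment> \<open>The series counts the gaps outlasted by the backlog; its mean
    \<open>lam * T\<close> is finite, so almost surely the count is.\<close>
  then have "AE \<omega> in M. (\<Sum>n. busy n \<omega>) \<noteq> \<infinity>"
    by (intro nn_integral_noteq_infinite) auto
  then show ex: "AE \<omega> in M. \<exists>n. Z n \<omega> \<le> gap (int n + 1) \<omega>"
  proof eventually_elim
    case (elim \<omega>)
    show ?case
    proof (rule ccontr)
      assume "\<not> ?thesis"
      then have *: "busy n \<omega> = 1" for n by (auto simp: busy_def not_le)
      obtain k where "(\<Sum>n. busy n \<omega>) < of_nat k"
        using elim ennreal_Ex_less_of_nat[of "\<Sum>n. busy n \<omega>"] by (auto simp: less_top)
      moreover have "(\<Sum>j<k. busy j \<omega>) \<le> (\<Sum>n. busy n \<omega>)"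
        by (intro sum_le_suminf summableI) auto
      ultimately show False by (simp add: *)
    qed
  qed
  \<comment> \<open>On almost every path the backlog is eventually 0, so the limit is taken pathwise
    and no convergence of the means of \<open>Z n\<close> to 0 has to be shown.\<close>
  have "AE \<omega> in M. (\<Sum>n. mins n \<omega>) = ennreal (F \<omega>) + (\<Sum>n. adds n \<omega>)"
    using ex pos
  proof eventually_elim
    case (elim \<omega>)
    then obtain n where n: "Z n \<omega> \<le> gap (int n + 1) \<omega>" by blast
    have bal: "ennreal (Z k \<omega>) + (\<Sum>j<k. mins j \<omega>) = ennreal (F \<omega>) + (\<Sum>j<k. adds j \<omega>)" for k
      unfolding Z_def mins_def adds_def by (rule backlog_balance) (use elim in auto)
    have "(\<Sum>j<k. mins j \<omega>) = ennreal (F \<omega>) + (\<Sum>j<k. adds j \<omega>)" if "n < k" for k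
    proof -
      have "Z k \<omega> = 0" unfolding Z_def
        by (rule backlog_eq_0[OF _ n[unfolded Z_def] that]) (use elim in auto)
      with bal[of k] show ?thesis by simp
    qed
    then have ev: "\<forall>\<^sub>F k in sequentially. ennreal (F \<omega>) + (\<Sum>j<k. adds j \<omega>) = (\<Sum>j<k. mins j \<omega>)"
      by (intro eventually_sequentiallyI[of "Suc n"]) simp
    have "(\<lambda>k. ennreal (F \<omega>) + (\<Sum>j<k. adds j \<omega>)) \<longlonglongrightarrow> ennreal (F \<omega>) + (\<Sum>n. adds n \<omega>)"
      by (intro tendsto_add tendsto_const summable_LIMSEQ summableI)
    then have "(\<lambda>k. \<Sum>j<k. mins j \<omega>) \<longlonglongrightarrow> ennreal (F \<omega>) + (\<Sum>n. adds n \<omega>)"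
      using ev by (rule Lim_transform_eventually)
    moreover have "(\<lambda>k. \<Sum>j<k. mins j \<omega>) \<longlonglongrightarrow> (\<Sum>n. mins n \<omega>)"
      by (intro summable_LIMSEQ summableI)
    ultimately show ?case by (rule LIMSEQ_unique[rotated])
  qed
  then have "(\<integral>\<^sup>+ \<omega>. (\<Sum>n. mins n \<omega>) \<partial>M) = (\<integral>\<^sup>+ \<omega>. ennreal (F \<omega>) + (\<Sum>n. adds n \<omega>) \<partial>M)"
    by (rule nn_integral_cong_AE)
  also have "(\<integral>\<^sup>+ \<omega>. (\<Sum>n. mins n \<omega>) \<partial>M) = T"
    unfolding T_def by (rule nn_integral_suminf) measurable
  also have "(\<integral>\<^sup>+ \<omega>. ennreal (F \<omega>) + (\<Sum>n. adds n \<omega>) \<partial>M) =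
      m0 + (\<integral>\<^sup>+ \<omega>. (\<Sum>n. adds n \<omega>) \<partial>M)"
    unfolding m0_def by (rule nn_integral_add) measurable
  also have "(\<integral>\<^sup>+ \<omega>. (\<Sum>n. adds n \<omega>) \<partial>M) = (\<Sum>n. \<integral>\<^sup>+ \<omega>. adds n \<omega> \<partial>M)"
    by (rule nn_integral_suminf) measurable
  also have "\<dots> = \<rho> * T"
    unfolding adds T_def by (rule ennreal_suminf_cmult)
  finally have "T = m0 + \<rho> * T" .
  then have "\<tau> = m + r * \<tau>"
    using r m T by (simp add: ennreal_mult'[symmetric] ennreal_plus[symmetric] del: ennreal_plus)
  then have "\<tau> = m / (1 - r)" using r by (simp add: field_simps)
  moreover have "1 - \<rho> = ennreal (1 - r)"
    using r by (metis ennreal_1 ennreal_minus)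
  ultimately have "T = m0 / (1 - \<rho>)"
    using r m T by (simp add: divide_ennreal)
  moreover have "(\<integral>\<^sup>+ \<omega>. clearing_time (\<lambda>k. gap k \<omega>) (ahead c1 \<omega>) (F \<omega>) \<partial>M) = T"
    unfolding clearing_time_def T_def by (simp add: nn_integral_suminf[symmetric] mins_def Z_def)
  ultimately show "(\<integral>\<^sup>+ \<omega>. clearing_time (\<lambda>k. gap k \<omega>) (ahead c1 \<omega>) (F \<omega>) \<partial>M) =
      (\<integral>\<^sup>+ \<omega>. ennreal (F \<omega>) \<partial>M) / (1 - rho_new lam c1 f p)"
    by (simp add: m0_def \<rho>_def)
qed

end

subsection \<open>The mean waiting time\<close>

text \<open>Fatou's lemma with convergent upper bounds. Unlike dominated convergence it does not
  presuppose an integrable limit, which matters for the second moment of the sizes.\<close>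

lemma nn_integral_limit_le:
  fixes h :: "nat \<Rightarrow> 'a \<Rightarrow> ennreal"
  assumes "\<And>n. h n \<in> borel_measurable N" and lim: "AE x in N. (\<lambda>n. h n x) \<longlonglongrightarrow> g x"
    and le: "\<And>n. (\<integral>\<^sup>+ x. h n x \<partial>N) \<le> C n" and C: "C \<longlonglongrightarrow> L"
  shows "(\<integral>\<^sup>+ x. g x \<partial>N) \<le> L"
proof -
  have "(\<integral>\<^sup>+ x. g x \<partial>N) = (\<integral>\<^sup>+ x. liminf (\<lambda>n. h n x) \<partial>N)"
    using lim by (intro nn_integral_cong_AE)
      (auto elim!: eventually_mono simp: lim_imp_Liminf)
  also have "\<dots> \<le> liminf (\<lambda>n. \<integral>\<^sup>+ x. h n x \<partial>N)"
    by (rule nn_integral_liminf) (fact assms(1))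
  also have "\<dots> \<le> liminf C"
    by (intro Liminf_mono always_eventually allI le)
  also have "\<dots> = L"
    using C by (intro lim_imp_Liminf) auto
  finally show ?thesis .
qed

lemma exp_minus_ge: "1 - x \<le> exp (- x)" for x :: real
  using exp_ge_add_one_self[of "- x"] by simp

lemma exp_minus_le:
  fixes x :: real
  assumes "0 \<le> x"
  shows "exp (- x) - 1 + x \<le> x\<^sup>2 / 2"
proof -
  let ?h = "\<lambda>x. x\<^sup>2 / 2 - (exp (- x) - 1 + x) :: real"
  have "?h 0 \<le> ?h x"
  proof (rule DERIV_nonneg_imp_nondecreasing[OF assms])
    fix y :: real
    have "(?h has_real_derivative y - (- exp (- y) + 1)) (at y)"
      by (auto intro!: derivative_eq_intros)
    then show "\<exists>d. (?h has_real_derivative d) (at y) \<and> 0 \<le> d"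
      using exp_minus_ge[of y] by (intro exI[of _ "y - (- exp (- y) + 1)"]) auto
  qed
  then show ?thesis by simp
qed

lemma tendsto_first_difference:
  "((\<lambda>\<theta>. (1 - exp (- \<theta> * x)) / \<theta>) \<longlongrightarrow> x) (at_right (0 :: real))" for x :: real
  by real_asymp

lemma tendsto_second_difference:
  "((\<lambda>\<theta>. (exp (- \<theta> * x) - 1 + \<theta> * x) / \<theta>\<^sup>2) \<longlongrightarrow> x\<^sup>2 / 2) (at_right (0 :: real))" for x :: real
  unfolding power2_eq_square by real_asymp

context job_stream
begin

lemma nn_integral_svc:
  assumes [measurable]: "h \<in> borel_measurable borel"
  shows "(\<integral>\<^sup>+ \<omega>. h (svc k \<omega>) \<partial>M) = (\<integral>\<^sup>+ x. ennreal (f x) * h x \<partial>lborel)"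
proof -
  have "(\<integral>\<^sup>+ \<omega>. h (svc k \<omega>) \<partial>M) = (\<integral>\<^sup>+ y. h (fst y) \<partial>svc_law)"
    using nn_integral_past_job[OF past_const[of "k - 1" 0], of "\<lambda>z. h (fst (snd (snd z)))"]
      prob_space.emeasure_space_1[OF prob_space_exp_law]
    by (simp add: job_def emeasure_space_1)
  then show ?thesis by (simp add: nn_integral_svc_law_fst)
qed

definition load :: "real \<Rightarrow> nat \<Rightarrow> int \<Rightarrow> 'w \<Rightarrow> real" where
  "load c1 m k \<omega> = workload (\<lambda>k. gap k \<omega>) (\<lambda>k. c1 + svc k \<omega>) m k"

text \<open>The work found by job \<open>k\<close> on arrival in a run that starts with job
  \<open>k - m\<close>; for \<open>k = 0\<close> the size of the tagged job does not enter.\<close>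

definition wait :: "real \<Rightarrow> nat \<Rightarrow> int \<Rightarrow> 'w \<Rightarrow> real" where
  "wait c1 m k \<omega> = max 0 (load c1 m (k - 1) \<omega> - gap k \<omega>)"

lemma load_0: "load c1 0 k \<omega> = 0"
  and load_Suc: "load c1 (Suc m) k \<omega> = wait c1 m k \<omega> + (c1 + svc k \<omega>)"
  by (simp_all add: load_def wait_def)

lemma past_load: "past k (load c1 m k)"
proof (induction m arbitrary: k)
  case 0
  then show ?case using past_const[of k 0] by (simp add: load_0[abs_def])
next
  case (Suc m)
  let ?h = "\<lambda>(v, e, x, b). max 0 (v - e) + (c1 + x) :: real"
  have "?h \<in> borel_measurable (borel \<Otimes>\<^sub>M job_space)" by measurable
  from past_step[OF Suc[of "k - 1"] this] show ?case
    by (simp add: job_def load_Suc[abs_def] wait_def)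
qed

lemma past_wait: "past k (wait c1 m k)"
proof -
  let ?h = "\<lambda>(v, e, x, b). max 0 (v - e) :: real"
  have "?h \<in> borel_measurable (borel \<Otimes>\<^sub>M job_space)" by measurable
  from past_step[OF past_load[of "k - 1"] this] show ?thesis
    by (simp add: job_def wait_def[abs_def])
qed

lemmas load_measurable [measurable] = past_measurable[OF past_load]
lemmas wait_measurable [measurable] = past_measurable[OF past_wait]

lemma wait_nonneg: "0 \<le> wait c1 m k \<omega>"
  by (simp add: wait_def)

lemma nn_integral_wait:
  assumes [measurable]: "h \<in> borel_measurable borel"
  shows "(\<integral>\<^sup>+ \<omega>. h (wait c1 m k \<omega>) \<partial>M) =
    (\<integral>\<^sup>+ \<omega>. \<integral>\<^sup>+ e. h (max 0 (load c1 m (k - 1) \<omega> - e)) \<partial>exp_law \<partial>M)"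
  using nn_integral_past_job[OF past_load[of "k - 1" c1 m], of "\<lambda>(v, e, y). h (max 0 (v - e))"]
    prob_space.emeasure_space_1[OF prob_space_svc_law]
  by (simp add: job_def wait_def)

lemma nn_integral_load_Suc:
  assumes [measurable]: "h \<in> borel_measurable borel"
  shows "(\<integral>\<^sup>+ \<omega>. h (load c1 (Suc m) k \<omega>) \<partial>M) =
    (\<integral>\<^sup>+ \<omega>. \<integral>\<^sup>+ e. \<integral>\<^sup>+ y. h (max 0 (load c1 m (k - 1) \<omega> - e) + (c1 + fst y)) \<partial>svc_law \<partial>exp_law \<partial>M)"
  using nn_integral_past_job[OF past_load[of "k - 1" c1 m], of "\<lambda>(v, e, y). h (max 0 (v - e) + (c1 + fst y))"]
  by (simp add: job_def load_Suc wait_def)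

text \<open>Each step integrates out one job, whose law does not depend on its index. The test
  function \<open>h\<close> is arbitrary in the induction because the step replaces it by its
  average over that job.\<close>

lemma load_stationary:
  assumes "h \<in> borel_measurable borel"
  shows "(\<integral>\<^sup>+ \<omega>. h (load c1 m k \<omega>) \<partial>M) = (\<integral>\<^sup>+ \<omega>. h (load c1 m k' \<omega>) \<partial>M)"
  using assms
proof (induction m arbitrary: h k k')
  case 0
  then show ?case by (simp add: load_0)
next
  case (Suc m)
  note [measurable] = Suc.prems
  interpret exp: prob_space exp_law by (rule prob_space_exp_law)
  interpret svc: prob_space svc_law by (rule prob_space_svc_law)
  have "(\<lambda>v. \<integral>\<^sup>+ e. \<integral>\<^sup>+ y. h (max 0 (v - e) + (c1 + fst y)) \<partial>svc_law \<partial>exp_law) \<in> borel_measurable borel"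
    by measurable
  from Suc.IH[OF this] show ?case
    by (simp only: nn_integral_load_Suc[OF Suc.prems])
qed

lemma wait_stationary:
  assumes [measurable]: "h \<in> borel_measurable borel"
  shows "(\<integral>\<^sup>+ \<omega>. h (wait c1 m k \<omega>) \<partial>M) = (\<integral>\<^sup>+ \<omega>. h (wait c1 m k' \<omega>) \<partial>M)"
proof -
  interpret exp: prob_space exp_law by (rule prob_space_exp_law)
  have "(\<lambda>v. \<integral>\<^sup>+ e. h (max 0 (v - e)) \<partial>exp_law) \<in> borel_measurable borel"
    by measurable
  from load_stationary[OF this] show ?thesis
    by (simp only: nn_integral_wait[OF assms])
qed

end

text \<open>
  The Pollaczek-Khinchine mean is derived from the recursion for the Laplace transforms of the waiting
  times, which only involves bounded quantities, so that no second moment has to be finite.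
\<close>

locale stable_stream = job_stream +
  fixes c1 :: real
  assumes c1_nonneg: "0 \<le> c1" and stable: "rho_c1 lam c1 f < 1"
begin

definition size :: "int \<Rightarrow> 'a \<Rightarrow> real" where "size k \<omega> = c1 + svc k \<omega>"

lemma size_measurable [measurable]: "size k \<in> borel_measurable M"
  unfolding size_def[abs_def] by measurable

lemma AE_size_pos: "AE \<omega> in M. 0 < size k \<omega>"
  using AE_svc_pos[of k] c1_nonneg by (auto elim!: eventually_mono simp: size_def)

lemma nn_integral_size:
  assumes [measurable]: "h \<in> borel_measurable borel"
  shows "(\<integral>\<^sup>+ \<omega>. h (size k \<omega>) \<partial>M) = (\<integral>\<^sup>+ x. ennreal (f x) * h (c1 + x) \<partial>lborel)"
  unfolding size_def by (rule nn_integral_svc[of "\<lambda>x. h (c1 + x)"]) measurable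

lemma rho_c1_eq: "rho_c1 lam c1 f = ennreal lam * (\<integral>\<^sup>+ \<omega>. ennreal (size k \<omega>) \<partial>M)"
  unfolding rho_c1_def
  by (subst nn_integral_size[of ennreal], measurable, rule arg_cong[where f="\<lambda>x. _ * x"], rule nn_integral_cong)
    (use f_nonneg f_support in \<open>auto simp: ennreal_mult'[symmetric] mult.commute add.commute split: split_indicator\<close>)

lemma second_moment_eq:
  "(\<integral>\<^sup>+ x\<in>{0<..}. ennreal ((x + c1)\<^sup>2 * f x) \<partial>lborel) = (\<integral>\<^sup>+ \<omega>. ennreal ((size k \<omega>)\<^sup>2) \<partial>M)"
  by (subst nn_integral_size[of "\<lambda>x. ennreal (x\<^sup>2)"], measurable, rule nn_integral_cong)
    (use f_nonneg f_support in \<open>auto simp: ennreal_mult'[symmetric] mult.commute add.commute split: split_indicator\<close>)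

lemma integrable_size: "integrable M (size k)"
proof -
  have "ennreal lam * (\<integral>\<^sup>+ \<omega>. ennreal (size k \<omega>) \<partial>M) < \<infinity>"
    using stable unfolding rho_c1_eq[of k] by (rule order_less_trans) simp
  then have "(\<integral>\<^sup>+ \<omega>. ennreal (size k \<omega>) \<partial>M) < \<infinity>"
    using lam_pos by (auto simp: ennreal_mult_less_top)
  then show ?thesis
    using AE_size_pos[of k] by (intro integrableI_nonneg) (auto elim!: eventually_mono)
qed

abbreviation mean_size :: real where "mean_size \<equiv> expectation (size 0)"

lemma nn_integral_size_eq: "(\<integral>\<^sup>+ \<omega>. ennreal (size k \<omega>) \<partial>M) = ennreal mean_size"
proof -
  have "(\<integral>\<^sup>+ \<omega>. ennreal (size k \<omega>) \<partial>M) = (\<integral>\<^sup>+ \<omega>. ennreal (size 0 \<omega>) \<partial>M)"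
    by (simp only: nn_integral_size[of ennreal, simplified])
  also have "\<dots> = ennreal mean_size"
    using AE_size_pos[of 0] by (intro nn_integral_eq_integral integrable_size) (auto elim!: eventually_mono)
  finally show ?thesis .
qed

lemma rho_c1_mean: "rho_c1 lam c1 f = ennreal (lam * mean_size)"
  using lam_pos by (simp add: rho_c1_eq[of 0] nn_integral_size_eq ennreal_mult'[symmetric])

lemma load_less_1: "lam * mean_size < 1"
  using stable by (simp add: rho_c1_mean ennreal_less_one_iff)

lemma AE_load_nonneg: "AE \<omega> in M. 0 \<le> load c1 m k \<omega>"
  using AE_pos
proof eventually_elim
  case (elim \<omega>)
  then have "0 \<le> c1 + svc k \<omega>" for k using c1_nonneg by (simp add: less_imp_le)
  then show ?case by (simp add: load_def workload_nonneg)
qed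

text \<open>In a fixed finite run the wait is at most a sum of finitely many sizes, each of finite
  mean. The supremum over \<open>m\<close> may still be infinite.\<close>

lemma nn_integral_wait_finite: "(\<integral>\<^sup>+ \<omega>. ennreal (wait c1 m k \<omega>) \<partial>M) < \<infinity>"
proof -
  have "(\<integral>\<^sup>+ \<omega>. ennreal (load c1 m k \<omega>) \<partial>M) < \<infinity> \<and> (\<integral>\<^sup>+ \<omega>. ennreal (wait c1 m k \<omega>) \<partial>M) < \<infinity>"
  proof (induction m arbitrary: k)
    case 0
    have "AE \<omega> in M. wait c1 0 k \<omega> = 0"
      using AE_gap_pos[of k] by eventually_elim (simp add: wait_def load_0)
    then have "(\<integral>\<^sup>+ \<omega>. ennreal (wait c1 0 k \<omega>) \<partial>M) = (\<integral>\<^sup>+ \<omega>. 0 \<partial>M)"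
      by (intro nn_integral_cong_AE) (auto elim!: eventually_mono)
    then show ?case by (simp add: load_0)
  next
    case (Suc m)
    have load: "(\<integral>\<^sup>+ \<omega>. ennreal (load c1 (Suc m) k \<omega>) \<partial>M) < \<infinity>" for k
    proof -
      have "(\<integral>\<^sup>+ \<omega>. ennreal (load c1 (Suc m) k \<omega>) \<partial>M) \<le>
          (\<integral>\<^sup>+ \<omega>. ennreal (wait c1 m k \<omega>) + ennreal (size k \<omega>) \<partial>M)"
        using AE_size_pos[of k]
        by (intro nn_integral_mono_AE)
          (auto elim!: eventually_mono simp: load_Suc size_def wait_nonneg)
      also have "\<dots> < \<infinity>"
        using Suc[of k] by (simp add: nn_integral_add nn_integral_size_eq)
      finally show ?thesis .
    qed
    have "(\<integral>\<^sup>+ \<omega>. ennreal (wait c1 (Suc m) k \<omega>) \<partial>M) \<le> (\<integral>\<^sup>+ \<omega>. ennreal (load c1 (Suc m) (k - 1) \<omega>) \<partial>M)"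
      using AE_gap_pos[of k] AE_load_nonneg[of "Suc m" "k - 1"]
      by (intro nn_integral_mono_AE, eventually_elim) (auto simp: wait_def intro!: ennreal_leI)
    also have "\<dots> < \<infinity>" by (rule load)
    finally show ?case using load by blast
  qed
  then show ?thesis ..
qed

lemma load_mono: "AE \<omega> in M. \<forall>k. load c1 m k \<omega> \<le> load c1 (Suc m) k \<omega>"
  using AE_pos
proof eventually_elim
  case (elim \<omega>)
  then have "0 \<le> c1 + svc k \<omega>" for k using c1_nonneg by (simp add: less_imp_le)
  then show ?case by (simp add: load_def workload_mono del: workload.simps)
qed

lemma wait_mono: "AE \<omega> in M. wait c1 m k \<omega> \<le> wait c1 (Suc m) k \<omega>"
  using load_mono[of m] by eventually_elim (auto simp: wait_def max_def dest: spec[of _ "k - 1"])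

section \<open>Laplace transforms of the Lindley recursion\<close>

definition laplace :: "real \<Rightarrow> ('a \<Rightarrow> real) \<Rightarrow> real" where
  "laplace \<theta> X = expectation (\<lambda>\<omega>. exp (- \<theta> * X \<omega>))"

lemma integrable_laplace:
  fixes X :: "'a \<Rightarrow> real"
  assumes [measurable]: "X \<in> borel_measurable M" and "AE \<omega> in M. 0 \<le> X \<omega>" "0 \<le> \<theta>"
  shows "integrable M (\<lambda>\<omega>. exp (- \<theta> * X \<omega>))"
proof (rule integrable_const_bound)
  show "AE \<omega> in M. norm (exp (- \<theta> * X \<omega>)) \<le> 1"
    using assms(2)
  proof eventually_elim
    case (elim \<omega>)
    then have "0 \<le> \<theta> * X \<omega>" using assms(3) by simp
    then show ?case by simp
  qed
qed measurable

lemma nn_integral_laplace: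
  assumes "X \<in> borel_measurable M" "AE \<omega> in M. 0 \<le> X \<omega>" "0 \<le> \<theta>"
  shows "(\<integral>\<^sup>+ \<omega>. ennreal (exp (- \<theta> * X \<omega>)) \<partial>M) = ennreal (laplace \<theta> X)"
  unfolding laplace_def by (intro nn_integral_eq_integral integrable_laplace assms) auto

lemma laplace_nonneg: "0 \<le> laplace \<theta> X"
  unfolding laplace_def by (rule Bochner_Integration.integral_nonneg) simp

lemma laplace_antimono:
  assumes [measurable]: "X \<in> borel_measurable M" "Y \<in> borel_measurable M"
    and "AE \<omega> in M. 0 \<le> X \<omega>" "AE \<omega> in M. X \<omega> \<le> Y \<omega>" "0 \<le> \<theta>"
  shows "laplace \<theta> Y \<le> laplace \<theta> X"
proof -
  have Y: "AE \<omega> in M. 0 \<le> Y \<omega>" using assms(3,4) by eventually_elim simp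
  show ?thesis
    unfolding laplace_def using assms Y
  proof (intro integral_mono_AE integrable_laplace)
    show "AE \<omega> in M. exp (- \<theta> * Y \<omega>) \<le> exp (- \<theta> * X \<omega>)"
      using assms(4) by eventually_elim (use assms(5) in \<open>simp add: mult_left_mono\<close>)
  qed auto
qed

lemma laplace_le_1:
  assumes "X \<in> borel_measurable M" "AE \<omega> in M. 0 \<le> X \<omega>" "0 \<le> \<theta>"
  shows "laplace \<theta> X \<le> 1"
  using laplace_antimono[of "\<lambda>_. 0" X \<theta>] assms by (simp add: laplace_def prob_space)

text \<open>The wait of job \<open>k\<close> depends only on earlier jobs and its own gap, and is
  therefore independent of its size.\<close>

lemma laplace_load_Suc:
  assumes "0 \<le> \<theta>"
  shows "laplace \<theta> (load c1 (Suc m) k) = laplace \<theta> (wait c1 m k) * laplace \<theta> (size 0)"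
proof -
  have "ennreal (laplace \<theta> (load c1 (Suc m) k)) = (\<integral>\<^sup>+ \<omega>. ennreal (exp (- \<theta> * load c1 (Suc m) k \<omega>)) \<partial>M)"
    using assms AE_load_nonneg by (intro nn_integral_laplace[symmetric]) auto
  also have "\<dots> = (\<integral>\<^sup>+ \<omega>. \<integral>\<^sup>+ e. \<integral>\<^sup>+ y. ennreal (exp (- \<theta> * max 0 (load c1 m (k - 1) \<omega> - e))) *
      ennreal (exp (- \<theta> * (c1 + fst y))) \<partial>svc_law \<partial>exp_law \<partial>M)"
    by (subst nn_integral_load_Suc[of "\<lambda>v. ennreal (exp (- \<theta> * v))"])
      (simp_all add: ennreal_mult'[symmetric] exp_add[symmetric] algebra_simps)
  also have "\<dots> = (\<integral>\<^sup>+ \<omega>. (\<integral>\<^sup>+ e. ennreal (exp (- \<theta> * max 0 (load c1 m (k - 1) \<omega> - e))) \<partial>exp_law) *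
      (\<integral>\<^sup>+ y. ennreal (exp (- \<theta> * (c1 + fst y))) \<partial>svc_law) \<partial>M)"
    by (simp add: nn_integral_cmult nn_integral_multc)
  also have "(\<integral>\<^sup>+ y. ennreal (exp (- \<theta> * (c1 + fst y))) \<partial>svc_law) = ennreal (laplace \<theta> (size 0))"
  proof -
    have "(\<integral>\<^sup>+ y. ennreal (exp (- \<theta> * (c1 + fst y))) \<partial>svc_law) =
        (\<integral>\<^sup>+ \<omega>. ennreal (exp (- \<theta> * size 0 \<omega>)) \<partial>M)"
      by (subst nn_integral_svc_law_fst[of "\<lambda>x. ennreal (exp (- \<theta> * (c1 + x)))"], measurable)
        (subst nn_integral_size[of "\<lambda>x. ennreal (exp (- \<theta> * x))"], measurable)
    also have "\<dots> = ennreal (laplace \<theta> (size 0))"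
      using assms AE_size_pos[of 0] by (intro nn_integral_laplace) (auto elim!: eventually_mono)
    finally show ?thesis .
  qed
  also have "(\<integral>\<^sup>+ \<omega>. (\<integral>\<^sup>+ e. ennreal (exp (- \<theta> * max 0 (load c1 m (k - 1) \<omega> - e))) \<partial>exp_law) *
      ennreal (laplace \<theta> (size 0)) \<partial>M) =
    (\<integral>\<^sup>+ \<omega>. (\<integral>\<^sup>+ e. ennreal (exp (- \<theta> * max 0 (load c1 m (k - 1) \<omega> - e))) \<partial>exp_law) \<partial>M) *
      ennreal (laplace \<theta> (size 0))"
  proof -
    interpret exp: prob_space exp_law by (rule prob_space_exp_law)
    show ?thesis by (rule nn_integral_multc) measurable
  qed
  also have "(\<integral>\<^sup>+ \<omega>. (\<integral>\<^sup>+ e. ennreal (exp (- \<theta> * max 0 (load c1 m (k - 1) \<omega> - e))) \<partial>exp_law) \<partial>M) =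
      ennreal (laplace \<theta> (wait c1 m k))"
    using assms nn_integral_wait[of "\<lambda>v. ennreal (exp (- \<theta> * v))" c1 m k]
      nn_integral_laplace[of "wait c1 m k" \<theta>] by (simp add: wait_nonneg)
  finally show ?thesis
    by (simp add: ennreal_mult'[symmetric] laplace_nonneg)
qed

lemma laplace_wait:
  assumes "0 \<le> \<theta>" "\<theta> < lam"
  shows "laplace \<theta> (wait c1 m k) * (lam - \<theta>) =
    lam * laplace \<theta> (load c1 m (k - 1)) - \<theta> * laplace lam (load c1 m (k - 1))"
proof -
  let ?u = "\<lambda>v. (lam * exp (- \<theta> * v) - \<theta> * exp (- lam * v)) / (lam - \<theta>)"
  have int: "integrable M (\<lambda>\<omega>. exp (- \<eta> * load c1 m (k - 1) \<omega>))" if "0 \<le> \<eta>" for \<eta>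
    using that by (intro integrable_laplace AE_load_nonneg) auto
  have int1: "integrable M (\<lambda>\<omega>. ?u (load c1 m (k - 1) \<omega>))"
    using assms lam_pos
    by (intro integrable_divide Bochner_Integration.integrable_diff integrable_mult_right int) auto
  have "ennreal (laplace \<theta> (wait c1 m k)) = (\<integral>\<^sup>+ \<omega>. ennreal (exp (- \<theta> * wait c1 m k \<omega>)) \<partial>M)"
    using assms by (intro nn_integral_laplace[symmetric]) (auto simp: wait_nonneg)
  also have "\<dots> = (\<integral>\<^sup>+ \<omega>. \<integral>\<^sup>+ e. ennreal (exp (- \<theta> * max 0 (load c1 m (k - 1) \<omega> - e))) \<partial>exp_law \<partial>M)"
    by (rule nn_integral_wait[of "\<lambda>v. ennreal (exp (- \<theta> * v))"]) measurable
  also have "\<dots> = (\<integral>\<^sup>+ \<omega>. ennreal (?u (load c1 m (k - 1) \<omega>)) \<partial>M)"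
    by (rule nn_integral_cong_AE, rule eventually_mono[OF AE_load_nonneg[of m "k - 1"]],
        rule exp_law_laplace[OF _ assms])
  also have "\<dots> = ennreal (expectation (\<lambda>\<omega>. ?u (load c1 m (k - 1) \<omega>)))"
  proof (rule nn_integral_eq_integral[OF int1])
    show "AE \<omega> in M. 0 \<le> ?u (load c1 m (k - 1) \<omega>)"
      using AE_load_nonneg[of m "k - 1"]
    proof eventually_elim
      case (elim \<omega>)
      let ?v = "load c1 m (k - 1) \<omega>"
      have "\<theta> * exp (- lam * ?v) \<le> lam * exp (- \<theta> * ?v)"
        using assms elim by (intro mult_mono) (auto intro!: mult_right_mono)
      then show ?case using assms by simp
    qed
  qed
  finally have "laplace \<theta> (wait c1 m k) = expectation (\<lambda>\<omega>. ?u (load c1 m (k - 1) \<omega>))"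
  proof (subst (asm) ennreal_inj)
    show "0 \<le> expectation (\<lambda>\<omega>. ?u (load c1 m (k - 1) \<omega>))"
      using AE_load_nonneg[of m "k - 1"]
    proof (intro integral_nonneg_AE, eventually_elim)
      case (elim \<omega>)
      let ?v = "load c1 m (k - 1) \<omega>"
      have "\<theta> * exp (- lam * ?v) \<le> lam * exp (- \<theta> * ?v)"
        using assms elim by (intro mult_mono) (auto intro!: mult_right_mono)
      then show ?case using assms by simp
    qed
  qed (auto simp: laplace_nonneg)
  also have "\<dots> = (lam * laplace \<theta> (load c1 m (k - 1)) - \<theta> * laplace lam (load c1 m (k - 1))) / (lam - \<theta>)"
    using int[of \<theta>] int[of lam] assms lam_pos by (simp add: laplace_def)
  finally show ?thesis using assms by simp
qed

lemma laplace_load_stationary: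
  assumes "0 \<le> \<theta>"
  shows "laplace \<theta> (load c1 m k) = laplace \<theta> (load c1 m k')"
proof -
  have "(\<integral>\<^sup>+ \<omega>. ennreal (exp (- \<theta> * load c1 m k \<omega>)) \<partial>M) = (\<integral>\<^sup>+ \<omega>. ennreal (exp (- \<theta> * load c1 m k' \<omega>)) \<partial>M)"
    by (rule load_stationary[of "\<lambda>v. ennreal (exp (- \<theta> * v))"]) measurable
  then show ?thesis
    using assms by (simp only: nn_integral_laplace[OF load_measurable AE_load_nonneg] ennreal_inj laplace_nonneg)
qed

lemma laplace_wait_stationary:
  assumes "0 \<le> \<theta>"
  shows "laplace \<theta> (wait c1 m k) = laplace \<theta> (wait c1 m k')"
proof -
  have pos: "AE \<omega> in M. 0 \<le> wait c1 m k \<omega>" for k by (simp add: wait_nonneg)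
  have "(\<integral>\<^sup>+ \<omega>. ennreal (exp (- \<theta> * wait c1 m k \<omega>)) \<partial>M) = (\<integral>\<^sup>+ \<omega>. ennreal (exp (- \<theta> * wait c1 m k' \<omega>)) \<partial>M)"
    by (rule wait_stationary[of "\<lambda>v. ennreal (exp (- \<theta> * v))"]) measurable
  then show ?thesis
    using assms by (simp only: nn_integral_laplace[OF wait_measurable pos] ennreal_inj laplace_nonneg)
qed

abbreviation \<psi> :: "nat \<Rightarrow> real \<Rightarrow> real" where "\<psi> m \<theta> \<equiv> laplace \<theta> (wait c1 m 0)"
text \<open>An exponential gap exceeds \<open>v\<close> with probability
  \<open>exp (- lam * v)\<close>, so this is the probability that the job after job 0 finds the
  system empty.\<close>

abbreviation \<kappa> :: "nat \<Rightarrow> real" where "\<kappa> m \<equiv> laplace lam (load c1 m 0)"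

text \<open>This is \<open>mean_size\<close> times the transform of the equilibrium (integrated
  tail) law of the sizes.\<close>

definition slope :: "real \<Rightarrow> real" where "slope \<theta> = (1 - laplace \<theta> (size 0)) / \<theta>"

lemma laplace_size: "0 < \<theta> \<Longrightarrow> laplace \<theta> (size 0) = 1 - \<theta> * slope \<theta>"
  by (simp add: slope_def)

text \<open>Arranged as an increment in \<open>m\<close>: its sign, known from monotonicity, bounds
  \<open>\<kappa>\<close>, and its vanishing in the limit gives the fixed-point equation.
  Stationarity moves index -1 back to 0.\<close>

lemma wait_recursion:
  assumes "0 < \<theta>" "\<theta> < lam"
  shows "\<psi> (Suc m) \<theta> * (lam - \<theta>) = \<psi> m \<theta> * (lam - \<theta>) + \<theta> * (\<psi> m \<theta> * (1 - lam * slope \<theta>) - \<kappa> (Suc m))"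
proof -
  have "\<psi> (Suc m) \<theta> * (lam - \<theta>) =
      lam * (laplace \<theta> (wait c1 m (-1)) * laplace \<theta> (size 0)) - \<theta> * laplace lam (load c1 (Suc m) (-1))"
    using assms by (simp add: laplace_wait laplace_load_Suc)
  also have "\<dots> = lam * (\<psi> m \<theta> * (1 - \<theta> * slope \<theta>)) - \<theta> * \<kappa> (Suc m)"
    using assms lam_pos laplace_wait_stationary[of \<theta> m "-1" 0] laplace_load_stationary[of lam "Suc m" "-1" 0]
    by (simp add: laplace_size)
  finally show ?thesis by (simp add: algebra_simps)
qed

lemma \<psi>_antimono: "0 \<le> \<theta> \<Longrightarrow> \<psi> (Suc m) \<theta> \<le> \<psi> m \<theta>"
  using wait_mono by (intro laplace_antimono) (auto simp: wait_nonneg)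

lemma \<kappa>_antimono: "\<kappa> (Suc m) \<le> \<kappa> m"
proof (intro laplace_antimono)
  show "AE \<omega> in M. load c1 m 0 \<omega> \<le> load c1 (Suc m) 0 \<omega>"
    using load_mono[of m] by eventually_elim simp
qed (use AE_load_nonneg lam_pos in auto)

lemma expectation_exp_ge:
  assumes "integrable M X" "AE \<omega> in M. 0 \<le> X \<omega>" "0 \<le> \<theta>"
  shows "1 - \<theta> * expectation X \<le> laplace \<theta> X"
proof -
  have [measurable]: "X \<in> borel_measurable M" using assms(1) by simp
  have "1 - \<theta> * expectation X = expectation (\<lambda>\<omega>. 1 - \<theta> * X \<omega>)"
    using assms(1) by (simp add: prob_space)
  also have "\<dots> \<le> laplace \<theta> X"
    unfolding laplace_def
  proof (rule integral_mono)
    show "integrable M (\<lambda>\<omega>. 1 - \<theta> * X \<omega>)" using assms(1) by simp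
    show "integrable M (\<lambda>\<omega>. exp (- \<theta> * X \<omega>))" using assms by (intro integrable_laplace) auto
    show "1 - \<theta> * X \<omega> \<le> exp (- \<theta> * X \<omega>)" for \<omega> using exp_minus_ge[of "\<theta> * X \<omega>"] by simp
  qed
  finally show ?thesis .
qed

lemma AE_size_nonneg: "AE \<omega> in M. 0 \<le> size k \<omega>"
  using AE_size_pos[of k] by eventually_elim simp

lemma slope_le: "0 < \<theta> \<Longrightarrow> slope \<theta> \<le> mean_size"
  using expectation_exp_ge[OF integrable_size AE_size_nonneg, of \<theta> 0]
  by (simp add: slope_def divide_simps mult.commute)

lemma integrable_wait: "integrable M (wait c1 m k)"
  using nn_integral_wait_finite[of m k] by (intro integrableI_nonneg) (auto simp: wait_nonneg)

lemma nn_integral_wait_eq: "(\<integral>\<^sup>+ \<omega>. ennreal (wait c1 m k \<omega>) \<partial>M) = ennreal (expectation (wait c1 m k))"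
  by (intro nn_integral_eq_integral integrable_wait) (simp add: wait_nonneg)

text \<open>A sequence tending to 0 from the right, so that sequential convergence theorems apply;
  the offset 2 keeps every term strictly below \<open>lam\<close>.\<close>

definition rate :: "nat \<Rightarrow> real" where "rate n = lam / (real n + 2)"

lemma rate: "0 < rate n" "rate n < lam"
  using lam_pos by (auto simp: rate_def divide_simps)

lemma rate_at_right: "filterlim rate (at_right 0) sequentially"
  unfolding filterlim_at
proof
  show "\<forall>\<^sub>F n in sequentially. rate n \<in> {0<..} \<and> rate n \<noteq> 0"
    using rate(1) by (auto intro!: always_eventually simp: less_imp_neq[THEN not_sym])
  show "rate \<longlonglongrightarrow> 0"
    unfolding rate_def[abs_def] by real_asymp
qed

lemma rate_lim: "rate \<longlonglongrightarrow> 0"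
  using rate_at_right by (simp add: filterlim_at)

text \<open>Waits grow with the length of the run, so their transforms decrease, and
  \<open>wait_recursion\<close> gives \<open>\<psi> m \<theta> * (1 - lam * slope \<theta>) \<le>
  \<kappa> (Suc m)\<close>. The mean wait of a finite run is finite, so
  \<open>\<psi> m \<theta>\<close> tends to 1 as \<open>\<theta>\<close> tends to 0.\<close>

lemma \<kappa>_ge: "1 - lam * mean_size \<le> \<kappa> (Suc m)"
proof -
  have "(1 - rate n * expectation (wait c1 m 0)) * (1 - lam * mean_size) \<le> \<kappa> (Suc m)" for n
  proof -
    have "rate n * (\<psi> m (rate n) * (1 - lam * slope (rate n)) - \<kappa> (Suc m)) =
        (\<psi> (Suc m) (rate n) - \<psi> m (rate n)) * (lam - rate n)"
      using wait_recursion[of "rate n" m] rate by (simp add: algebra_simps)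
    also have "\<dots> \<le> 0"
      using \<psi>_antimono[of "rate n" m] rate[of n] by (intro mult_nonpos_nonneg) auto
    finally have *: "\<psi> m (rate n) * (1 - lam * slope (rate n)) \<le> \<kappa> (Suc m)"
      using rate(1)[of n] by (simp add: mult_le_0_iff)
    have "(1 - rate n * expectation (wait c1 m 0)) * (1 - lam * mean_size) \<le>
        \<psi> m (rate n) * (1 - lam * mean_size)"
      using expectation_exp_ge[OF integrable_wait, of m 0 "rate n"] rate(1)[of n] load_less_1
      by (intro mult_right_mono) (auto simp: wait_nonneg)
    also have "\<dots> \<le> \<psi> m (rate n) * (1 - lam * slope (rate n))"
      using slope_le[OF rate(1)[of n]] lam_pos by (intro mult_left_mono laplace_nonneg) auto
    finally show ?thesis using * by simp
  qed
  moreover have "(\<lambda>n. (1 - rate n * expectation (wait c1 m 0)) * (1 - lam * mean_size)) \<longlonglongrightarrow>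
      (1 - 0 * expectation (wait c1 m 0)) * (1 - lam * mean_size)"
    by (intro tendsto_intros rate_lim)
  ultimately show ?thesis
    by (auto intro: LIMSEQ_le_const2)
qed

lemma slope_tendsto: "(\<lambda>n. slope (rate n)) \<longlonglongrightarrow> mean_size"
proof -
  have r: "slope (rate n) = expectation (\<lambda>\<omega>. (1 - exp (- rate n * size 0 \<omega>)) / rate n)" for n
    using integrable_laplace[OF size_measurable AE_size_nonneg, of "rate n" 0] rate(1)[of n]
    by (simp add: slope_def laplace_def prob_space)
  show ?thesis
    unfolding r
  proof (rule integral_dominated_convergence[where w = "size 0"])
    show "AE \<omega> in M. (\<lambda>n. (1 - exp (- rate n * size 0 \<omega>)) / rate n) \<longlonglongrightarrow> size 0 \<omega>"
      using filterlim_compose[OF tendsto_first_difference rate_at_right] by simp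
    show "AE \<omega> in M. norm ((1 - exp (- rate n * size 0 \<omega>)) / rate n) \<le> size 0 \<omega>" for n
      using AE_size_nonneg[of 0]
    proof eventually_elim
      case (elim \<omega>)
      have "0 \<le> rate n * size 0 \<omega>" using elim rate(1)[of n] by simp
      then have "0 \<le> 1 - exp (- rate n * size 0 \<omega>)" by simp
      moreover have "1 - exp (- rate n * size 0 \<omega>) \<le> rate n * size 0 \<omega>"
        using exp_minus_ge[of "rate n * size 0 \<omega>"] by simp
      ultimately show ?case
        using rate(1)[of n] by (simp add: divide_simps mult.commute)
    qed
  qed (use integrable_size in auto)
qed

text \<open>A limit of transforms rather than the transform of a limit, so that no stationary
  waiting time has to be constructed.\<close>

definition \<psi>_inf :: "real \<Rightarrow> real" where "\<psi>_inf \<theta> = lim (\<lambda>m. \<psi> m \<theta>)"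

lemma \<psi>_tendsto:
  assumes "0 \<le> \<theta>"
  shows "(\<lambda>m. \<psi> m \<theta>) \<longlonglongrightarrow> \<psi>_inf \<theta>" "\<psi>_inf \<theta> \<le> \<psi> m \<theta>"
proof -
  have dec: "decseq (\<lambda>m. \<psi> m \<theta>)"
    using \<psi>_antimono[OF assms] by (rule decseq_SucI)
  then have "convergent (\<lambda>m. \<psi> m \<theta>)"
    by (metis decseq_convergent convergentI laplace_nonneg)
  then show lim: "(\<lambda>m. \<psi> m \<theta>) \<longlonglongrightarrow> \<psi>_inf \<theta>"
    unfolding \<psi>_inf_def by (simp add: convergent_LIMSEQ_iff)
  show "\<psi>_inf \<theta> \<le> \<psi> m \<theta>"
    using dec lim by (rule decseq_ge)
qed

text \<open>
  In the limit the recursion reads \<open>\<psi>_inf \<theta> (1 - lam slope \<theta>) = K\<close>; letting \<open>\<theta>\<close> tend to 0 shows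
  \<open>K = 1 - lam mean_size\<close>, which is the Pollaczek-Khinchine transform.
\<close>

lemma pollaczek_khinchine:
  assumes "0 < \<theta>" "\<theta> < lam"
  shows "\<psi>_inf \<theta> * (1 - lam * slope \<theta>) = 1 - lam * mean_size"
proof -
  have dec: "decseq \<kappa>" using \<kappa>_antimono by (rule decseq_SucI)
  then obtain K where K: "\<kappa> \<longlonglongrightarrow> K"
    by (metis decseq_convergent laplace_nonneg)
  have lim: "\<psi>_inf \<theta> * (1 - lam * slope \<theta>) = K" if \<theta>: "0 < \<theta>" "\<theta> < lam" for \<theta>
  proof -
    have \<psi>: "(\<lambda>m. \<psi> m \<theta>) \<longlonglongrightarrow> \<psi>_inf \<theta>" using \<psi>_tendsto(1)[of \<theta>] \<theta> by simp
    have "(\<lambda>m. \<psi> (Suc m) \<theta> * (lam - \<theta>)) \<longlonglongrightarrow> \<psi>_inf \<theta> * (lam - \<theta>)"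
      by (intro tendsto_intros LIMSEQ_Suc[OF \<psi>])
    moreover have "(\<lambda>m. \<psi> m \<theta> * (lam - \<theta>) + \<theta> * (\<psi> m \<theta> * (1 - lam * slope \<theta>) - \<kappa> (Suc m))) \<longlonglongrightarrow>
        \<psi>_inf \<theta> * (lam - \<theta>) + \<theta> * (\<psi>_inf \<theta> * (1 - lam * slope \<theta>) - K)"
      by (intro tendsto_intros \<psi> LIMSEQ_Suc[OF K])
    ultimately have "\<psi>_inf \<theta> * (lam - \<theta>) = \<psi>_inf \<theta> * (lam - \<theta>) + \<theta> * (\<psi>_inf \<theta> * (1 - lam * slope \<theta>) - K)"
      by (simp only: wait_recursion[OF \<theta>]) (rule LIMSEQ_unique)
    then show ?thesis using \<theta> by simp
  qed
  \<comment> \<open>\<open>K\<close> is squeezed: from below by the bound for finite runs, from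
    above by \<open>\<psi>_inf \<theta> \<le> 1\<close>. This takes the place of continuity of
    \<open>\<psi>_inf\<close> at 0, which would require tightness of the waits.\<close>
  have "1 - lam * mean_size \<le> K"
    using LIMSEQ_Suc[OF K] by (rule LIMSEQ_le_const) (use \<kappa>_ge in blast)
  moreover have "K \<le> 1 - lam * mean_size"
  proof (rule LIMSEQ_le_const)
    show "(\<lambda>n. 1 - lam * slope (rate n)) \<longlonglongrightarrow> 1 - lam * mean_size"
      by (intro tendsto_intros slope_tendsto)
    have "K \<le> 1 - lam * slope (rate n)" for n
    proof -
      have "lam * slope (rate n) \<le> lam * mean_size"
        using slope_le[OF rate(1)[of n]] lam_pos by simp
      then have "0 \<le> 1 - lam * slope (rate n)" using load_less_1 by simp
      moreover have "\<psi>_inf (rate n) \<le> 1"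
        using \<psi>_tendsto(2)[of "rate n" 0] laplace_le_1[of "wait c1 0 0" "rate n"] rate(1)[of n]
        by (simp add: wait_nonneg)
      ultimately have "\<psi>_inf (rate n) * (1 - lam * slope (rate n)) \<le> 1 * (1 - lam * slope (rate n))"
        by (intro mult_right_mono) auto
      then show ?thesis using lim[OF rate, of n] by simp
    qed
    then show "\<exists>N. \<forall>n\<ge>N. K \<le> 1 - lam * slope (rate n)" by blast
  qed
  ultimately show ?thesis using lim[OF assms] by simp
qed

section \<open>From the transform to the mean wait\<close>

lemma nn_integral_size_second_difference:
  assumes "0 < \<theta>"
  shows "(\<integral>\<^sup>+ \<omega>. ennreal ((exp (- \<theta> * size 0 \<omega>) - 1 + \<theta> * size 0 \<omega>) / \<theta>\<^sup>2) \<partial>M) =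
    ennreal ((mean_size - slope \<theta>) / \<theta>)"
proof -
  have int: "integrable M (\<lambda>\<omega>. exp (- \<theta> * size 0 \<omega>))"
    using assms by (intro integrable_laplace AE_size_nonneg) auto
  have "(\<integral>\<^sup>+ \<omega>. ennreal ((exp (- \<theta> * size 0 \<omega>) - 1 + \<theta> * size 0 \<omega>) / \<theta>\<^sup>2) \<partial>M) =
      ennreal (expectation (\<lambda>\<omega>. (exp (- \<theta> * size 0 \<omega>) - 1 + \<theta> * size 0 \<omega>) / \<theta>\<^sup>2))"
  proof (rule nn_integral_eq_integral)
    show "integrable M (\<lambda>\<omega>. (exp (- \<theta> * size 0 \<omega>) - 1 + \<theta> * size 0 \<omega>) / \<theta>\<^sup>2)"
      using int integrable_size by simp
    have "0 \<le> exp (- \<theta> * x) - 1 + \<theta> * x" for x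
      using exp_minus_ge[of "\<theta> * x"] by simp
    then show "AE \<omega> in M. 0 \<le> (exp (- \<theta> * size 0 \<omega>) - 1 + \<theta> * size 0 \<omega>) / \<theta>\<^sup>2"
      by (intro always_eventually allI divide_nonneg_nonneg) auto
  qed
  also have "expectation (\<lambda>\<omega>. (exp (- \<theta> * size 0 \<omega>) - 1 + \<theta> * size 0 \<omega>) / \<theta>\<^sup>2) =
      (laplace \<theta> (size 0) - 1 + \<theta> * mean_size) / \<theta>\<^sup>2"
    using int integrable_size by (simp add: laplace_def prob_space)
  also have "\<dots> = (mean_size - slope \<theta>) / \<theta>"
    using assms by (simp add: laplace_size power2_eq_square divide_simps) (simp add: algebra_simps)
  finally show ?thesis .
qed

text \<open>The Pollaczek-Khinchine mean at positive \<open>\<theta>\<close>: a first difference for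
  the waits against the second difference for the sizes, which in the limit stands for half their
  second moment.\<close>

lemma \<psi>_inf_eq:
  assumes "0 < \<theta>" "\<theta> < lam"
  shows "(1 - \<psi>_inf \<theta>) / \<theta> * (1 - lam * slope \<theta>) = lam * ((mean_size - slope \<theta>) / \<theta>)"
proof -
  have "(1 - \<psi>_inf \<theta>) * (1 - lam * slope \<theta>) = lam * (mean_size - slope \<theta>)"
    using pollaczek_khinchine[OF assms] by (simp add: algebra_simps)
  then show ?thesis by (simp add: field_simps)
qed

lemma slope_bound: "0 < \<theta> \<Longrightarrow> 1 - lam * mean_size \<le> 1 - lam * slope \<theta>"
  using slope_le[of \<theta>] lam_pos by simp

text \<open>Both inequalities follow from \<open>\<psi>_inf_eq\<close> by Fatou, applied to the
  difference quotients of the waits in one direction and of the sizes in the other. Neither needs a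
  finite second moment; both sides may be infinite together.\<close>

lemma mean_wait:
  "(SUP m. \<integral>\<^sup>+ \<omega>. ennreal (wait c1 m 0 \<omega>) \<partial>M) =
    ennreal (lam / (1 - lam * mean_size)) * (\<integral>\<^sup>+ \<omega>. ennreal ((size 0 \<omega>)\<^sup>2 / 2) \<partial>M)" (is "?L = ?c * ?m2")
proof (rule antisym)
  show "?L \<le> ?c * ?m2"
  proof (rule SUP_least)
    fix m
    show "(\<integral>\<^sup>+ \<omega>. ennreal (wait c1 m 0 \<omega>) \<partial>M) \<le> ?c * ?m2"
    proof (rule nn_integral_limit_le[OF _ _ _ tendsto_const])
      show "AE \<omega> in M. (\<lambda>n. ennreal ((1 - exp (- rate n * wait c1 m 0 \<omega>)) / rate n)) \<longlonglongrightarrow> ennreal (wait c1 m 0 \<omega>)"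
        using filterlim_compose[OF tendsto_first_difference rate_at_right] by (intro AE_I2 tendsto_ennrealI)
      fix n
      let ?\<theta> = "rate n"
      have pos: "0 < 1 - lam * slope ?\<theta>"
        using slope_bound[OF rate(1)[of n]] load_less_1 by linarith
      have int: "integrable M (\<lambda>\<omega>. exp (- ?\<theta> * wait c1 m 0 \<omega>))"
        using rate(1)[of n] by (intro integrable_laplace) (auto simp: wait_nonneg)
      have "(\<integral>\<^sup>+ \<omega>. ennreal ((1 - exp (- ?\<theta> * wait c1 m 0 \<omega>)) / ?\<theta>) \<partial>M) =
          ennreal (expectation (\<lambda>\<omega>. (1 - exp (- ?\<theta> * wait c1 m 0 \<omega>)) / ?\<theta>))"
        using rate(1)[of n] int by (intro nn_integral_eq_integral) (auto simp: wait_nonneg)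
      also have "expectation (\<lambda>\<omega>. (1 - exp (- ?\<theta> * wait c1 m 0 \<omega>)) / ?\<theta>) = (1 - \<psi> m ?\<theta>) / ?\<theta>"
        using int by (simp add: laplace_def prob_space)
      \<comment> \<open>Transforms decrease in \<open>m\<close>, so the quotient of a finite run is
        at most that of the limit.\<close>
      also have "\<dots> \<le> (1 - \<psi>_inf ?\<theta>) / ?\<theta>"
        using rate(1)[of n] \<psi>_tendsto(2)[of ?\<theta> m] by (intro divide_right_mono) auto
      also have "(1 - \<psi>_inf ?\<theta>) / ?\<theta> = lam * ((mean_size - slope ?\<theta>) / ?\<theta>) / (1 - lam * slope ?\<theta>)"
        using pos by (intro nonzero_eq_divide_eq[THEN iffD2] \<psi>_inf_eq[OF rate]) auto
      \<comment> \<open>Replacing \<open>slope\<close> by the larger \<open>mean_size\<close> only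
        shrinks the positive denominator.\<close>
      also have "\<dots> \<le> lam * ((mean_size - slope ?\<theta>) / ?\<theta>) / (1 - lam * mean_size)"
        using rate(1)[of n] slope_le[OF rate(1)[of n]] slope_bound[OF rate(1)[of n]] load_less_1 lam_pos pos
        by (intro divide_left_mono mult_nonneg_nonneg divide_nonneg_nonneg mult_pos_pos) auto
      also have "\<dots> = lam / (1 - lam * mean_size) * ((mean_size - slope ?\<theta>) / ?\<theta>)"
        by simp
      also have "ennreal \<dots> = ?c * ennreal ((mean_size - slope ?\<theta>) / ?\<theta>)"
        using load_less_1 lam_pos by (intro ennreal_mult') auto
      also have "\<dots> = ?c * (\<integral>\<^sup>+ \<omega>. ennreal ((exp (- ?\<theta> * size 0 \<omega>) - 1 + ?\<theta> * size 0 \<omega>) / ?\<theta>\<^sup>2) \<partial>M)"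
        by (simp only: nn_integral_size_second_difference[OF rate(1)])
      also have "\<dots> \<le> ?c * ?m2"
      proof (intro mult_left_mono nn_integral_mono_AE)
        show "AE \<omega> in M. ennreal ((exp (- ?\<theta> * size 0 \<omega>) - 1 + ?\<theta> * size 0 \<omega>) / ?\<theta>\<^sup>2) \<le> ennreal ((size 0 \<omega>)\<^sup>2 / 2)"
          using AE_size_nonneg[of 0]
        proof eventually_elim
          case (elim \<omega>)
          then have "exp (- (?\<theta> * size 0 \<omega>)) - 1 + ?\<theta> * size 0 \<omega> \<le> (?\<theta> * size 0 \<omega>)\<^sup>2 / 2"
            using rate(1)[of n] by (intro exp_minus_le) simp
          then show ?case
            using rate(1)[of n] by (intro ennreal_leI) (simp add: power_mult_distrib divide_simps mult_ac)
        qed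
      qed simp
      finally show "(\<integral>\<^sup>+ \<omega>. ennreal ((1 - exp (- ?\<theta> * wait c1 m 0 \<omega>)) / ?\<theta>) \<partial>M) \<le> ?c * ?m2"
        by (simp add: ennreal_leI)
    qed measurable
  qed
  show "?c * ?m2 \<le> ?L"
  proof (cases ?L)
    \<comment> \<open>A finite supremum \<open>x\<close> bounds all difference quotients of the
      waits, and through \<open>\<psi>_inf_eq\<close> and Fatou it bounds the second moment.\<close>
    case (real x)
    have "?m2 \<le> ennreal (x * (1 - lam * mean_size) / lam)"
    proof (rule nn_integral_limit_le)
      show "AE \<omega> in M. (\<lambda>n. ennreal ((exp (- rate n * size 0 \<omega>) - 1 + rate n * size 0 \<omega>) / (rate n)\<^sup>2)) \<longlonglongrightarrow>
          ennreal ((size 0 \<omega>)\<^sup>2 / 2)"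
        using filterlim_compose[OF tendsto_second_difference rate_at_right] by (intro AE_I2 tendsto_ennrealI)
      show "(\<lambda>n. ennreal (x * (1 - lam * slope (rate n)) / lam)) \<longlonglongrightarrow> ennreal (x * (1 - lam * mean_size) / lam)"
        using lam_pos by (intro tendsto_ennrealI tendsto_intros slope_tendsto) auto
      fix n
      let ?\<theta> = "rate n"
      have "(1 - \<psi> m ?\<theta>) / ?\<theta> \<le> x" for m
      proof -
        have "ennreal (expectation (wait c1 m 0)) \<le> ?L"
          unfolding nn_integral_wait_eq[symmetric] by (rule SUP_upper) simp
        then have "expectation (wait c1 m 0) \<le> x"
          using real by simp
        then have "?\<theta> * expectation (wait c1 m 0) \<le> ?\<theta> * x"
          using rate(1)[of n] by (intro mult_left_mono) auto
        moreover have "1 - ?\<theta> * expectation (wait c1 m 0) \<le> \<psi> m ?\<theta>"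
          using expectation_exp_ge[OF integrable_wait, of m 0 ?\<theta>] rate(1)[of n]
          by (simp add: wait_nonneg)
        ultimately have "1 - \<psi> m ?\<theta> \<le> ?\<theta> * x"
          by linarith
        then show ?thesis
          using rate(1)[of n] by (simp add: pos_divide_le_eq mult.commute)
      qed
      moreover have "(\<lambda>m. (1 - \<psi> m ?\<theta>) / ?\<theta>) \<longlonglongrightarrow> (1 - \<psi>_inf ?\<theta>) / ?\<theta>"
        using rate(1)[of n] by (intro tendsto_intros \<psi>_tendsto) auto
      ultimately have "(1 - \<psi>_inf ?\<theta>) / ?\<theta> \<le> x"
        by (auto intro: LIMSEQ_le_const2)
      then have "(1 - \<psi>_inf ?\<theta>) / ?\<theta> * (1 - lam * slope ?\<theta>) \<le> x * (1 - lam * slope ?\<theta>)"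
        using slope_bound[OF rate(1)[of n]] load_less_1 by (intro mult_right_mono) auto
      then have "(mean_size - slope ?\<theta>) / ?\<theta> \<le> x * (1 - lam * slope ?\<theta>) / lam"
        unfolding \<psi>_inf_eq[OF rate] using lam_pos by (simp add: pos_le_divide_eq mult.commute)
      then show "(\<integral>\<^sup>+ \<omega>. ennreal ((exp (- ?\<theta> * size 0 \<omega>) - 1 + ?\<theta> * size 0 \<omega>) / ?\<theta>\<^sup>2) \<partial>M) \<le>
          ennreal (x * (1 - lam * slope ?\<theta>) / lam)"
        unfolding nn_integral_size_second_difference[OF rate(1)] by (rule ennreal_leI)
    qed measurable
    then have "?c * ?m2 \<le> ?c * ennreal (x * (1 - lam * mean_size) / lam)"
      by (rule mult_left_mono) simp
    also have "\<dots> = ennreal x"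
      using lam_pos load_less_1 real by (simp add: ennreal_mult'[symmetric])
    finally show ?thesis using real by simp
  next
    case top
    then show ?thesis by (simp only: top_greatest)
  qed
qed

end

subsection \<open>The response time\<close>

text \<open>Prescribing size and bit of job 0 leaves the work of the jobs before it unchanged;
  \<open>backlog_cong\<close> serves the same purpose for the jobs after it.\<close>

lemma workload_cong: "(\<And>i. i \<le> k \<Longrightarrow> s i = s' i) \<Longrightarrow> workload g s n k = workload g s' n k"
  by (induction n arbitrary: k) auto

lemma backlog_cong: "(\<And>i. 0 < i \<Longrightarrow> y i = y' i) \<Longrightarrow> backlog g y z n = backlog g y' z n"
  by (induction n) auto

context stable_stream
begin

lemma rho_new_le: "rho_new lam c1 f p \<le> rho_c1 lam c1 f"
proof -
  \<comment> \<open>Under \<open>svc_law\<close> service times are positive only up to a null set;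
    \<open>max 0\<close> makes the comparison hold pointwise.\<close>
  have "(\<integral>\<^sup>+ y. ennreal (if snd y then c1 + fst y else c1) \<partial>svc_law) \<le>
      (\<integral>\<^sup>+ y. ennreal (c1 + max 0 (fst y)) \<partial>svc_law)"
    by (intro nn_integral_mono ennreal_leI) auto
  also have "\<dots> = (\<integral>\<^sup>+ x. ennreal (f x) * ennreal (c1 + max 0 x) \<partial>lborel)"
    by (rule nn_integral_svc_law_fst) measurable
  also have "\<dots> = (\<integral>\<^sup>+ x\<in>{0<..}. ennreal ((x + c1) * f x) \<partial>lborel)"
    using c1_nonneg f_nonneg f_support
    by (intro nn_integral_cong) (auto simp: ennreal_mult'[symmetric] algebra_simps split: split_indicator)
  finally show ?thesis
    unfolding rho_new_eq[OF c1_nonneg] rho_c1_def by (rule mult_left_mono) simp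
qed

section \<open>The tagged job in runs from the past\<close>

context
  fixes xJ :: real
    and age :: "nat \<Rightarrow> 'a \<Rightarrow> int \<Rightarrow> real \<Rightarrow> real"
  assumes xJ: "c1 < xJ" and run: "run_from_past M c1 xJ gap svc short age"
begin

abbreviation response :: "nat \<Rightarrow> 'a \<Rightarrow> ennreal" where
  "response m \<omega> \<equiv> clearing_time (\<lambda>k. gap k \<omega>) (ahead c1 \<omega>) (wait c1 m 0 \<omega> + xJ)"

lemma past_start: "past 0 (\<lambda>\<omega>. wait c1 m 0 \<omega> + xJ)"
proof -
  let ?h = "\<lambda>(v, e, x, b). max 0 (v - e) + xJ :: real"
  have "?h \<in> borel_measurable (borel \<Otimes>\<^sub>M job_space)" by measurable
  from past_step[OF past_load[of "- 1" c1 m] this] show ?thesis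
    by (simp add: job_def wait_def)
qed

lemma xJ_pos: "0 < xJ"
  using xJ c1_nonneg by simp

lemma nn_integral_start: "(\<integral>\<^sup>+ \<omega>. ennreal (wait c1 m 0 \<omega> + xJ) \<partial>M) = (\<integral>\<^sup>+ \<omega>. ennreal (wait c1 m 0 \<omega>) \<partial>M) + ennreal xJ"
proof -
  have "(\<integral>\<^sup>+ \<omega>. ennreal (wait c1 m 0 \<omega> + xJ) \<partial>M) = (\<integral>\<^sup>+ \<omega>. ennreal (wait c1 m 0 \<omega>) + ennreal xJ \<partial>M)"
    using xJ_pos by (intro nn_integral_cong) (simp add: wait_nonneg)
  then show ?thesis by (simp add: nn_integral_add emeasure_space_1)
qed

lemma response_integral:
  shows "AE \<omega> in M. \<exists>n. backlog (\<lambda>k. gap k \<omega>) (ahead c1 \<omega>) (wait c1 m 0 \<omega> + xJ) n \<le> gap (int n + 1) \<omega>"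
    and "(\<integral>\<^sup>+ \<omega>. response m \<omega> \<partial>M) =
      ((\<integral>\<^sup>+ \<omega>. ennreal (wait c1 m 0 \<omega>) \<partial>M) + ennreal xJ) / (1 - rho_new lam c1 f p)"
proof -
  have nonneg: "AE \<omega> in M. 0 \<le> wait c1 m 0 \<omega> + xJ"
    using xJ_pos wait_nonneg by (auto intro!: always_eventually add_nonneg_nonneg)
  have finite: "(\<integral>\<^sup>+ \<omega>. ennreal (wait c1 m 0 \<omega> + xJ) \<partial>M) < \<infinity>"
    using nn_integral_wait_finite[of m 0] by (simp add: nn_integral_start)
  have rho: "rho_new lam c1 f p < 1"
    using rho_new_le stable by (rule order_le_less_trans)
  note * = nn_integral_clearing_time[OF past_start nonneg c1_nonneg finite rho]
  show "AE \<omega> in M. \<exists>n. backlog (\<lambda>k. gap k \<omega>) (ahead c1 \<omega>) (wait c1 m 0 \<omega> + xJ) n \<le> gap (int n + 1) \<omega>"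
    by (rule *(1))
  show "(\<integral>\<^sup>+ \<omega>. response m \<omega> \<partial>M) =
      ((\<integral>\<^sup>+ \<omega>. ennreal (wait c1 m 0 \<omega>) \<partial>M) + ennreal xJ) / (1 - rho_new lam c1 f p)"
    unfolding *(2) nn_integral_start ..
qed

text \<open>Almost every path satisfies the assumptions of \<open>one_bit_path\<close> and clears
  its backlog. There are countably many runs, so one null set serves all \<open>m\<close>, as
  pathwise convergence in \<open>m\<close> requires.\<close>

lemma past_response_eq: "AE \<omega> in M. \<forall>m. past_response c1 xJ gap svc age m \<omega> = response m \<omega>"
proof -
  have "AE \<omega> in M. \<forall>m. \<exists>n. backlog (\<lambda>k. gap k \<omega>) (ahead c1 \<omega>) (wait c1 m 0 \<omega> + xJ) n \<le> gap (int n + 1) \<omega>"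
    using response_integral(1) by (simp add: AE_all_countable)
  with AE_pos run[unfolded run_from_past_def] show ?thesis
  proof eventually_elim
    case (elim \<omega>)
    show ?case
    proof
      fix m
      let ?arr = "arrival (\<lambda>k. gap k \<omega>)" and ?sz = "tagged_size c1 xJ svc \<omega>" and ?bit = "tagged_bit short \<omega>"
      interpret path: one_bit_path c1 m ?arr ?sz ?bit "age m \<omega>"
      proof
        show "c1 < ?sz k" for k
          using elim(1) xJ by (simp add: tagged_size_def)
        show "strict_mono ?arr" using elim(1) by (intro strict_mono_arrival) auto
        show "one_bit_schedule c1 {- int m..} ?arr ?sz ?bit (age m \<omega>)" using elim(2) by blast
      qed (rule c1_nonneg)
      have gap: "path.gap = (\<lambda>k. gap k \<omega>)"
        by (simp add: fun_eq_iff path.gap_def arrival_diff)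
      have target: "path.target i = ahead c1 \<omega> i" if "0 < i" for i
        using that unfolding path.target_def
        by (simp add: ahead_def tagged_size_def tagged_bit_def)
      have "workload (\<lambda>k. gap k \<omega>) ?sz m (- 1) = load c1 m (- 1) \<omega>"
        unfolding load_def by (rule workload_cong) (simp add: tagged_size_def)
      then have start: "workload path.gap ?sz (Suc m) 0 = wait c1 m 0 \<omega> + xJ"
        by (simp add: gap wait_def tagged_size_def)
      have back_eq: "backlog path.gap path.target z n = backlog (\<lambda>k. gap k \<omega>) (ahead c1 \<omega>) z n" for z n
        unfolding gap by (rule backlog_cong) (rule target)
      have "response_time ?arr ?sz (age m \<omega>) 0 = clearing_time path.gap path.target (workload path.gap ?sz (Suc m) 0)"
      proof (rule path.response_time_eq)
        show "\<not> ?bit 0" by (simp add: tagged_bit_def)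
        show "\<exists>n. backlog path.gap path.target (workload path.gap ?sz (Suc m) 0) n \<le> path.gap (int n + 1)"
          unfolding back_eq start using elim(3) by (simp add: gap)
      qed
      also have "\<dots> = response m \<omega>"
        unfolding clearing_time_def back_eq start by (simp add: gap)
      finally show "past_response c1 xJ gap svc age m \<omega> = response m \<omega>"
        by (simp add: past_response_def)
    qed
  qed
qed

lemma response_mono: "AE \<omega> in M. \<forall>m. response m \<omega> \<le> response (Suc m) \<omega>"
proof -
  have "AE \<omega> in M. \<forall>m. wait c1 m 0 \<omega> \<le> wait c1 (Suc m) 0 \<omega>"
    using wait_mono by (simp add: AE_all_countable)
  with AE_pos show ?thesis
  proof eventually_elim
    case (elim \<omega>)
    then have "0 \<le> ahead c1 \<omega> k" for k
      using c1_nonneg by (simp add: ahead_def less_imp_le)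
    then show ?case
      using elim by (intro allI clearing_time_mono) auto
  qed
qed

lemma response_measurable [measurable]: "response m \<in> borel_measurable M"
proof -
  note [measurable] = past_measurable[OF past_backlog[OF past_start]]
  show ?thesis unfolding clearing_time_def by measurable
qed

text \<open>A longer past only adds work, so the responses increase with \<open>m\<close> and
  converge in \<open>ennreal\<close> to their supremum.\<close>

lemma response_limit:
  "AE \<omega> in M. convergent (\<lambda>m. past_response c1 xJ gap svc age m \<omega>) \<and>
    equilibrium_response c1 xJ gap svc age \<omega> = (SUP m. response m \<omega>)"
  using past_response_eq response_mono
proof eventually_elim
  case (elim \<omega>)
  then have "(\<lambda>m. past_response c1 xJ gap svc age m \<omega>) \<longlonglongrightarrow> (SUP m. response m \<omega>)"
    by (simp add: LIMSEQ_SUP incseq_SucI)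
  then show ?case
    by (auto simp: equilibrium_response_def convergent_def limI)
qed

lemma nn_integral_equilibrium_response:
  "(\<integral>\<^sup>+ \<omega>. equilibrium_response c1 xJ gap svc age \<omega> \<partial>M) =
    (ennreal (lam / (1 - lam * mean_size)) * (\<integral>\<^sup>+ \<omega>. ennreal ((size 0 \<omega>)\<^sup>2 / 2) \<partial>M) + ennreal xJ) /
      (1 - rho_new lam c1 f p)"
proof -
  have "(\<integral>\<^sup>+ \<omega>. equilibrium_response c1 xJ gap svc age \<omega> \<partial>M) = (\<integral>\<^sup>+ \<omega>. (SUP m. response m \<omega>) \<partial>M)"
    using response_limit by (intro nn_integral_cong_AE) (auto elim!: eventually_mono)
  also have "\<dots> = (SUP m. \<integral>\<^sup>+ \<omega>. response m \<omega> \<partial>M)"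
    using response_mono by (intro nn_integral_monotone_convergence_SUP_AE) (auto elim!: eventually_mono)
  also have "\<dots> = ((SUP m. \<integral>\<^sup>+ \<omega>. ennreal (wait c1 m 0 \<omega>) \<partial>M) + ennreal xJ) / (1 - rho_new lam c1 f p)"
    unfolding response_integral(2) SUP_divide_ennreal[symmetric] by (simp add: ennreal_SUP_add_left)
  finally show ?thesis by (simp add: mean_wait)
qed

end

end

theorem lemma10:
  fixes M :: "'w measure"
    and lam c1 xJ :: real
    and f p :: "real \<Rightarrow> real"
    and gap svc :: "int \<Rightarrow> 'w \<Rightarrow> real"
    and short :: "int \<Rightarrow> 'w \<Rightarrow> bool"
    and age :: "nat \<Rightarrow> 'w \<Rightarrow> int \<Rightarrow> real \<Rightarrow> real"
  assumes "job_stream M lam f p gap svc short"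
    and "0 \<le> c1"
    and "rho_c1 lam c1 f < 1"
    and "c1 < xJ"
    and "run_from_past M c1 xJ gap svc short age"
  shows "(AE \<omega> in M. convergent (\<lambda>m. past_response c1 xJ gap svc age m \<omega>)) \<and>
    (\<integral>\<^sup>+ \<omega>. equilibrium_response c1 xJ gap svc age \<omega> \<partial>M) =
      ennreal lam / (2 * (1 - rho_c1 lam c1 f) * (1 - rho_new lam c1 f p)) *
        (\<integral>\<^sup>+ x\<in>{0<..}. ennreal ((x + c1)\<^sup>2 * f x) \<partial>lborel)
      + (\<integral>\<^sup>+ a\<in>{0..xJ}. 1 / (1 - rho_new lam c1 f p) \<partial>lborel)"
proof -
  interpret job_stream M lam f p gap svc short by (rule assms(1))
  interpret stable_stream M lam f p gap svc short c1
    by unfold_locales (rule assms)+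
  let ?m2 = "\<integral>\<^sup>+ x\<in>{0<..}. ennreal ((x + c1)\<^sup>2 * f x) \<partial>lborel"
  have conv: "AE \<omega> in M. convergent (\<lambda>m. past_response c1 xJ gap svc age m \<omega>)"
    using response_limit[OF assms(4,5)] by eventually_elim simp
  \<comment> \<open>Both loads are below 1 and hence real, so the coefficients are computed in the
    reals; the second moment stays in \<open>ennreal\<close>, as it may be infinite.\<close>
  obtain q where q: "rho_new lam c1 f p = ennreal q" "0 \<le> q" "q < 1"
    using rho_new_le stable by (cases "rho_new lam c1 f p") (auto simp: ennreal_less_one_iff top_unique
        dest: order_le_less_trans)
  have s: "0 \<le> lam * mean_size" "lam * mean_size < 1"
    using load_less_1 lam_pos integral_nonneg_AE[OF AE_size_nonneg] by simp_all
  have diff: "1 - ennreal x = ennreal (1 - x)" if "0 \<le> x" for x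
    using that by (metis ennreal_1 ennreal_minus)
  have half: "(\<integral>\<^sup>+ \<omega>. ennreal ((size 0 \<omega>)\<^sup>2 / 2) \<partial>M) = ennreal (1 / 2) * ?m2"
    unfolding second_moment_eq[of 0]
    by (subst nn_integral_cmult[symmetric])
      (auto intro!: nn_integral_cong simp: ennreal_mult'[symmetric] simp del: ennreal_half)
  have "(\<integral>\<^sup>+ \<omega>. equilibrium_response c1 xJ gap svc age \<omega> \<partial>M) =
      (ennreal (lam / (1 - lam * mean_size)) * (ennreal (1 / 2) * ?m2) + ennreal xJ) / ennreal (1 - q)"
    unfolding nn_integral_equilibrium_response[OF assms(4,5)] half using q by (simp add: diff)
  also have "\<dots> = ennreal (1 / (1 - q)) * (ennreal (lam / (1 - lam * mean_size)) * (ennreal (1 / 2) * ?m2) + ennreal xJ)"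
    using q by (simp add: divide_ennreal_def inverse_ennreal inverse_eq_divide mult.commute)
  also have "\<dots> = ennreal (lam / (2 * (1 - lam * mean_size) * (1 - q))) * ?m2 + ennreal (1 / (1 - q)) * ennreal xJ"
  proof -
    have "ennreal (1 / (1 - q)) * (ennreal (lam / (1 - lam * mean_size)) * ennreal (1 / 2)) =
        ennreal (1 / (1 - q) * (lam / (1 - lam * mean_size) * (1 / 2)))"
      using q s lam_pos by (subst ennreal_mult, simp, simp, subst ennreal_mult) auto
    also have "1 / (1 - q) * (lam / (1 - lam * mean_size) * (1 / 2)) =
        lam / (2 * (1 - lam * mean_size) * (1 - q))"
      by simp
    finally show ?thesis by (simp only: distrib_left mult.assoc[symmetric])
  qed
  also have "ennreal (lam / (2 * (1 - lam * mean_size) * (1 - q))) =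
      ennreal lam / (2 * (1 - rho_c1 lam c1 f) * (1 - rho_new lam c1 f p))"
  proof -
    have "2 * (1 - rho_c1 lam c1 f) * (1 - rho_new lam c1 f p) = ennreal (2 * (1 - lam * mean_size) * (1 - q))"
    proof -
      have "ennreal (2 * (1 - lam * mean_size) * (1 - q)) = ennreal 2 * ennreal (1 - lam * mean_size) * ennreal (1 - q)"
        using q s by (subst ennreal_mult, simp, simp, subst ennreal_mult) auto
      then show ?thesis using q s by (simp add: rho_c1_mean diff del: ennreal_plus)
    qed
    then show ?thesis using q s lam_pos by (simp add: divide_ennreal)
  qed
  also have "ennreal (1 / (1 - q)) * ennreal xJ = (\<integral>\<^sup>+ a\<in>{0..xJ}. 1 / (1 - rho_new lam c1 f p) \<partial>lborel)"
  proof -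
    have "1 / (1 - rho_new lam c1 f p) = ennreal (1 / (1 - q))"
      using q by (simp add: diff divide_ennreal[symmetric])
    then show ?thesis
      using assms(2,4) by (simp add: nn_integral_cmult_indicator)
  qed
  finally show ?thesis using conv by blast
qed

end
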